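(* Let $R$ be a commutative noetherian ring and let $A$ be an $R$-algebra with property $\mathbf{P_\ell}$. Then $(A^\circ,A,\langle-,-\rangle)$, with $\langle f,a\rangle=f(a)$, is a rational system; i.e. for every $R$-module $M$ the map $\alpha_M:M\otimes_R A^\circ\to\mathrm{Hom}_R(A,M)$, $m\otimes f\mapsto[a\mapsto m f(a)]$, is injective.
   Context: Algebras are associative with unit. $A^*=\mathrm{Hom}_R(A,R)$ is a left $A$-module via $(af)(b)=f(ba)$, and $A^\circ=\{f\in A^*: Af\text{ is a finitely generated }R\text{-module}\}$; for $R$ noetherian, $f\in A^\circ$ iff $\ker f$ contains a left ideal $I$ of $A$ with $A/I$ finitely generated over $R$ (equivalently such a right, or two-sided, ideal). Property $\mathbf{P_\ell}$: for every left ideal $I$ of $A$ with $A/I$ finitely generated as an $R$-module, there is a left ideal $I_0\subseteq I$ of $A$ with $A/I_0$ finitely generated and projective as an $R$-module. $\mathrm{P_\ell Alg}_R$ denotes the full subcategory of $R$-algebras with this property. *)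

theory Defs
  imports "HOL-Algebra.Module" "HOL-Algebra.Ring_Divisibility" "HOL-Algebra.Free_Abelian_Groups"
begin

(* The library's algebra locale is for commutative algebras only. *)
locale assoc_algebra = module R A + ring A for R (structure) and A (structure) +
  assumes smult_mult_left:
      "\<lbrakk>r \<in> carrier R; a \<in> carrier A; b \<in> carrier A\<rbrakk> \<Longrightarrow>
        (r \<odot>\<^bsub>A\<^esub> a) \<otimes>\<^bsub>A\<^esub> b = r \<odot>\<^bsub>A\<^esub> (a \<otimes>\<^bsub>A\<^esub> b)"
    and smult_mult_right:
      "\<lbrakk>r \<in> carrier R; a \<in> carrier A; b \<in> carrier A\<rbrakk> \<Longrightarrow>
        a \<otimes>\<^bsub>A\<^esub> (r \<odot>\<^bsub>A\<^esub> b) = r \<odot>\<^bsub>A\<^esub> (a \<otimes>\<^bsub>A\<^esub> b)"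

(* Module homomorphisms are extensional functions, so that equality of functions is
   equality on the carrier.  In the modules constructed below the ring multiplication
   and unit, which the module record inherits, are meaningless. *)
definition mod_hom ::
    "('r, 'x) ring_scheme \<Rightarrow> ('r, 'm, 'y) module_scheme \<Rightarrow> ('r, 'n, 'z) module_scheme
      \<Rightarrow> ('m \<Rightarrow> 'n) set" where
  "mod_hom R M N = {h \<in> carrier M \<rightarrow>\<^sub>E carrier N.
     (\<forall>x\<in>carrier M. \<forall>y\<in>carrier M. h (x \<oplus>\<^bsub>M\<^esub> y) = h x \<oplus>\<^bsub>N\<^esub> h y) \<and>
     (\<forall>r\<in>carrier R. \<forall>x\<in>carrier M. h (r \<odot>\<^bsub>M\<^esub> x) = r \<odot>\<^bsub>N\<^esub> h x)}"

definition hom_module ::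
    "('r, 'x) ring_scheme \<Rightarrow> ('r, 'm, 'y) module_scheme \<Rightarrow> ('r, 'n, 'z) module_scheme
      \<Rightarrow> ('r, 'm \<Rightarrow> 'n) module" where
  "hom_module R M N =
     \<lparr>carrier = mod_hom R M N, monoid.mult = undefined, one = undefined,
      ring.zero = (\<lambda>x\<in>carrier M. \<zero>\<^bsub>N\<^esub>),
      ring.add = (\<lambda>g h. \<lambda>x\<in>carrier M. g x \<oplus>\<^bsub>N\<^esub> h x),
      module.smult = (\<lambda>r h. \<lambda>x\<in>carrier M. r \<odot>\<^bsub>N\<^esub> h x)\<rparr>"

definition self_module :: "('r, 'x) ring_scheme \<Rightarrow> ('r, 'r) module" where
  "self_module R =
     \<lparr>carrier = carrier R, monoid.mult = monoid.mult R, one = one R, ring.zero = ring.zero R, ring.add = ring.add R,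
      module.smult = monoid.mult R\<rparr>"

definition fin_gen_module ::
    "('r, 'x) ring_scheme \<Rightarrow> ('r, 'm, 'y) module_scheme \<Rightarrow> bool" where
  "fin_gen_module R M \<longleftrightarrow>
     (\<exists>S. finite S \<and> S \<subseteq> carrier M \<and> (\<forall>H. submodule H R M \<and> S \<subseteq> H \<longrightarrow> H = carrier M))"

(* The lifting property along surjections N -> N'.  A definition cannot quantify over types,
   so N' has the element type of P and N the type of coefficient functions on P.  This
   loses nothing: the canonical surjection onto P from the free module on the set carrier P
   (finitely supported functions into R) is among the surjections considered, and if it
   splits then P is a direct summand of a free module and hence lifts along every
   surjection of modules. *)
definition projective_module ::
    "('r, 'x) ring_scheme \<Rightarrow> ('r, 'p, 'y) module_scheme \<Rightarrow> bool" where
  "projective_module R P \<longleftrightarrow>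
     module R P \<and>
     (\<forall>(N :: ('r, 'p \<Rightarrow> 'r) module) (N' :: ('r, 'p) module) g h.
        module R N \<longrightarrow> module R N' \<longrightarrow>
        g \<in> mod_hom R N N' \<longrightarrow> g ` carrier N = carrier N' \<longrightarrow>
        h \<in> mod_hom R P N' \<longrightarrow>
        (\<exists>k\<in>mod_hom R P N. \<forall>x\<in>carrier P. g (k x) = h x))"

definition left_ideal :: "'a set \<Rightarrow> ('a, 'x) ring_scheme \<Rightarrow> bool" where
  "left_ideal I A \<longleftrightarrow> additive_subgroup I A \<and> (\<forall>a\<in>carrier A. \<forall>x\<in>I. a \<otimes>\<^bsub>A\<^esub> x \<in> I)"

definition quot_module :: "('r, 'm, 'y) module_scheme \<Rightarrow> 'm set \<Rightarrow> ('r, 'm set) module" where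
  "quot_module M I =
     \<lparr>carrier = a_rcosets\<^bsub>M\<^esub> I, monoid.mult = undefined, one = undefined,
      ring.zero = I,
      ring.add = set_add M,
      module.smult = (\<lambda>r C. \<Union>x\<in>C. I +>\<^bsub>M\<^esub> (r \<odot>\<^bsub>M\<^esub> x))\<rparr>"

definition property_Pl ::
    "('r, 'x) ring_scheme \<Rightarrow> ('r, 'a, 'y) module_scheme \<Rightarrow> bool" where
  "property_Pl R A \<longleftrightarrow>
     (\<forall>I. left_ideal I A \<and> fin_gen_module R (quot_module A I) \<longrightarrow>
        (\<exists>I0. left_ideal I0 A \<and> I0 \<subseteq> I \<and>
           fin_gen_module R (quot_module A I0) \<and> projective_module R (quot_module A I0)))"

definition dual_module ::
    "('r, 'x) ring_scheme \<Rightarrow> ('r, 'm, 'y) module_scheme \<Rightarrow> ('r, 'm \<Rightarrow> 'r) module" where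
  "dual_module R M = hom_module R M (self_module R)"

definition dual_act :: "('a, 'x) ring_scheme \<Rightarrow> 'a \<Rightarrow> ('a \<Rightarrow> 'r) \<Rightarrow> 'a \<Rightarrow> 'r" where
  "dual_act A a f = (\<lambda>b\<in>carrier A. f (b \<otimes>\<^bsub>A\<^esub> a))"

definition finite_dual ::
    "('r, 'x) ring_scheme \<Rightarrow> ('r, 'a, 'y) module_scheme \<Rightarrow> ('r, 'a \<Rightarrow> 'r) module" where
  "finite_dual R A = (dual_module R A)
     \<lparr>carrier := {f \<in> carrier (dual_module R A).
        fin_gen_module R ((dual_module R A)\<lparr>carrier := (\<lambda>a. dual_act A a f) ` carrier A\<rparr>)}\<rparr>"

(* The tensor product of M and T over R, as the free abelian group on the pairs modulo
   biadditivity and R-balancedness.  Only its additive group is constructed, written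
   multiplicatively as a quotient in the library's sense. *)
definition tensor_relations ::
    "('r, 'x) ring_scheme \<Rightarrow> ('r, 'm, 'y) module_scheme \<Rightarrow> ('r, 't, 'z) module_scheme
      \<Rightarrow> ('m \<times> 't \<Rightarrow>\<^sub>0 int) set" where
  "tensor_relations R M T =
     {frag_of (m \<oplus>\<^bsub>M\<^esub> m', t) - frag_of (m, t) - frag_of (m', t) | m m' t.
        m \<in> carrier M \<and> m' \<in> carrier M \<and> t \<in> carrier T} \<union>
     {frag_of (m, t \<oplus>\<^bsub>T\<^esub> t') - frag_of (m, t) - frag_of (m, t') | m t t'.
        m \<in> carrier M \<and> t \<in> carrier T \<and> t' \<in> carrier T} \<union>
     {frag_of (r \<odot>\<^bsub>M\<^esub> m, t) - frag_of (m, r \<odot>\<^bsub>T\<^esub> t) | r m t.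
        r \<in> carrier R \<and> m \<in> carrier M \<and> t \<in> carrier T}"

definition tensor_kernel ::
    "('r, 'x) ring_scheme \<Rightarrow> ('r, 'm, 'y) module_scheme \<Rightarrow> ('r, 't, 'z) module_scheme
      \<Rightarrow> ('m \<times> 't \<Rightarrow>\<^sub>0 int) set" where
  "tensor_kernel R M T =
     generate (free_Abelian_group (carrier M \<times> carrier T)) (tensor_relations R M T)"

definition tensor_product ::
    "('r, 'x) ring_scheme \<Rightarrow> ('r, 'm, 'y) module_scheme \<Rightarrow> ('r, 't, 'z) module_scheme
      \<Rightarrow> ('m \<times> 't \<Rightarrow>\<^sub>0 int) set monoid" where
  "tensor_product R M T =
     free_Abelian_group (carrier M \<times> carrier T) Mod tensor_kernel R M T"

definition pure_tensor ::
    "('r, 'x) ring_scheme \<Rightarrow> ('r, 'm, 'y) module_scheme \<Rightarrow> ('r, 't, 'z) module_scheme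
      \<Rightarrow> 'm \<Rightarrow> 't \<Rightarrow> ('m \<times> 't \<Rightarrow>\<^sub>0 int) set" where
  "pure_tensor R M T m t =
     tensor_kernel R M T #>\<^bsub>free_Abelian_group (carrier M \<times> carrier T)\<^esub> frag_of (m, t)"

definition bilinear_pairing ::
    "('r, 'x) ring_scheme \<Rightarrow> ('r, 't, 'z) module_scheme \<Rightarrow> ('r, 'a, 'y) module_scheme
      \<Rightarrow> ('t \<Rightarrow> 'a \<Rightarrow> 'r) \<Rightarrow> bool" where
  "bilinear_pairing R T A pr \<longleftrightarrow>
     (\<forall>t\<in>carrier T. (\<lambda>a\<in>carrier A. pr t a) \<in> mod_hom R A (self_module R)) \<and>
     (\<forall>a\<in>carrier A. (\<lambda>t\<in>carrier T. pr t a) \<in> mod_hom R T (self_module R))"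

(* The additive map determined by its values on pure tensors; alpha_map_ex1 below shows
   that the description is proper. *)
definition is_alpha_map ::
    "('r, 'x) ring_scheme \<Rightarrow> ('r, 't, 'z) module_scheme \<Rightarrow> ('r, 'a, 'y) module_scheme
      \<Rightarrow> ('t \<Rightarrow> 'a \<Rightarrow> 'r) \<Rightarrow> ('r, 'm, 'w) module_scheme
      \<Rightarrow> (('m \<times> 't \<Rightarrow>\<^sub>0 int) set \<Rightarrow> 'a \<Rightarrow> 'm) \<Rightarrow> bool" where
  "is_alpha_map R T A pr M \<alpha> \<longleftrightarrow>
     \<alpha> \<in> extensional (carrier (tensor_product R M T)) \<and>
     \<alpha> \<in> hom (tensor_product R M T) (add_monoid (hom_module R A M)) \<and>
     (\<forall>m\<in>carrier M. \<forall>t\<in>carrier T.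
        \<alpha> (pure_tensor R M T m t) = (\<lambda>a\<in>carrier A. pr t a \<odot>\<^bsub>M\<^esub> m))"

definition alpha_map ::
    "('r, 'x) ring_scheme \<Rightarrow> ('r, 't, 'z) module_scheme \<Rightarrow> ('r, 'a, 'y) module_scheme
      \<Rightarrow> ('t \<Rightarrow> 'a \<Rightarrow> 'r) \<Rightarrow> ('r, 'm, 'w) module_scheme
      \<Rightarrow> ('m \<times> 't \<Rightarrow>\<^sub>0 int) set \<Rightarrow> 'a \<Rightarrow> 'm" where
  "alpha_map R T A pr M = (THE \<alpha>. is_alpha_map R T A pr M \<alpha>)"

(* The type argument is the element type of the test modules M; a theorem that is
   polymorphic in it speaks about all R-modules. *)
definition rational_system ::
    "'m itself \<Rightarrow> ('r, 'x) ring_scheme \<Rightarrow> ('r, 't, 'z) module_scheme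
      \<Rightarrow> ('r, 'a, 'y) module_scheme \<Rightarrow> ('t \<Rightarrow> 'a \<Rightarrow> 'r) \<Rightarrow> bool" where
  "rational_system _ R T A pr \<longleftrightarrow>
     module R T \<and> assoc_algebra R A \<and> bilinear_pairing R T A pr \<and>
     (\<forall>M :: ('r, 'm) module. module R M \<longrightarrow>
        inj_on (alpha_map R T A pr M) (carrier (tensor_product R M T)))"

lemma comm_group_hom_module:
  assumes A: "module R A" and M: "module R M"
  shows "comm_group (add_monoid (hom_module R A M))"
proof -
  interpret A: module R A by fact
  interpret M: module R M by fact
  show ?thesis
  proof (rule comm_groupI, simp_all add: hom_module_def)
    fix g h assume "g \<in> mod_hom R A M" "h \<in> mod_hom R A M"
    then show "(\<lambda>x\<in>carrier A. g x \<oplus>\<^bsub>M\<^esub> h x) \<in> mod_hom R A M"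
      by (auto simp: mod_hom_def PiE_iff M.add.m_ac M.smult_r_distr)
    from \<open>g \<in> mod_hom R A M\<close> \<open>h \<in> mod_hom R A M\<close>
    show "(\<lambda>x\<in>carrier A. g x \<oplus>\<^bsub>M\<^esub> h x) = (\<lambda>x\<in>carrier A. h x \<oplus>\<^bsub>M\<^esub> g x)"
      by (auto simp: mod_hom_def PiE_iff M.add.m_comm)
  next
    show "(\<lambda>x\<in>carrier A. \<zero>\<^bsub>M\<^esub>) \<in> mod_hom R A M"
      by (auto simp: mod_hom_def PiE_iff)
  next
    fix f g h assume "f \<in> mod_hom R A M" "g \<in> mod_hom R A M" "h \<in> mod_hom R A M"
    then show "(\<lambda>x\<in>carrier A. (if x \<in> carrier A then f x \<oplus>\<^bsub>M\<^esub> g x else undefined) \<oplus>\<^bsub>M\<^esub> h x) =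
       (\<lambda>x\<in>carrier A. f x \<oplus>\<^bsub>M\<^esub> (if x \<in> carrier A then g x \<oplus>\<^bsub>M\<^esub> h x else undefined))"
      by (auto simp: mod_hom_def PiE_iff M.add.m_assoc)
  next
    fix h assume h: "h \<in> mod_hom R A M"
    then show "(\<lambda>x\<in>carrier A. (if x \<in> carrier A then \<zero>\<^bsub>M\<^esub> else undefined) \<oplus>\<^bsub>M\<^esub> h x) = h"
      by (auto simp: mod_hom_def PiE_iff extensional_def)
    have "(\<lambda>x\<in>carrier A. \<ominus>\<^bsub>M\<^esub> h x) \<in> mod_hom R A M"
      using h by (auto simp: mod_hom_def PiE_iff M.minus_add M.smult_r_minus)
    moreover have "(\<lambda>x\<in>carrier A. (if x \<in> carrier A then \<ominus>\<^bsub>M\<^esub> h x else undefined) \<oplus>\<^bsub>M\<^esub> h x) =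
        (\<lambda>x\<in>carrier A. \<zero>\<^bsub>M\<^esub>)"
      using h by (auto simp: mod_hom_def PiE_iff M.l_neg)
    ultimately show "\<exists>g\<in>mod_hom R A M. (\<lambda>x\<in>carrier A. g x \<oplus>\<^bsub>M\<^esub> h x) = (\<lambda>x\<in>carrier A. \<zero>\<^bsub>M\<^esub>)"
      by (intro bexI) auto
  qed
qed

lemma normal_tensor_kernel:
  assumes M: "module R M" and T: "module R T"
  shows "tensor_kernel R M T \<lhd> free_Abelian_group (carrier M \<times> carrier T)"
    and "tensor_relations R M T \<subseteq> carrier (free_Abelian_group (carrier M \<times> carrier T))"
proof -
  interpret M: module R M by fact
  interpret T: module R T by fact
  let ?F = "free_Abelian_group (carrier M \<times> carrier T)"
  interpret F: comm_group ?F by (rule abelian_free_Abelian_group)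
  have diff: "Poly_Mapping.keys (x - y) \<subseteq> carrier M \<times> carrier T"
    if "Poly_Mapping.keys x \<subseteq> carrier M \<times> carrier T"
      "Poly_Mapping.keys y \<subseteq> carrier M \<times> carrier T" for x y
    using that keys_diff [of x y] by blast
  show rel: "tensor_relations R M T \<subseteq> carrier ?F"
  proof
    fix c assume "c \<in> tensor_relations R M T"
    then show "c \<in> carrier ?F"
      unfolding tensor_relations_def carrier_free_Abelian_group_iff
      by (elim UnE CollectE exE conjE; hypsubst) (intro diff; simp)+
  qed
  have "subgroup (tensor_kernel R M T) ?F"
    unfolding tensor_kernel_def by (rule F.generate_is_subgroup [OF rel])
  then show "tensor_kernel R M T \<lhd> ?F"
    by (rule F.subgroup_imp_normal)
qed

lemma alpha_map_ex1:
  assumes T: "module R T" and A: "module R A" and pr: "bilinear_pairing R T A pr"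
    and M: "module R M"
  shows "\<exists>!\<alpha>. is_alpha_map R T A pr M \<alpha>"
proof -
  interpret M: module R M by fact
  interpret T: module R T by fact
  interpret A: module R A by fact
  let ?F = "free_Abelian_group (carrier M \<times> carrier T)"
  let ?K = "tensor_kernel R M T"
  let ?H = "add_monoid (hom_module R A M)"
  interpret F: comm_group ?F by (rule abelian_free_Abelian_group)
  interpret H: comm_group ?H by (rule comm_group_hom_module [OF A M])
  have norm: "?K \<lhd> ?F" and rel: "tensor_relations R M T \<subseteq> carrier ?F"
    using normal_tensor_kernel [OF M T] by auto
  have carT: "carrier (tensor_product R M T) = (\<lambda>x. ?K #>\<^bsub>?F\<^esub> x) ` carrier ?F"
    by (auto simp: tensor_product_def FactGroup_def RCOSETS_def)
  define v where "v = (\<lambda>(m, t). \<lambda>a\<in>carrier A. pr t a \<odot>\<^bsub>M\<^esub> m)"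
  have prc: "pr t a \<in> carrier R" if "t \<in> carrier T" "a \<in> carrier A" for t a
    using pr that by (fastforce simp: bilinear_pairing_def mod_hom_def self_module_def PiE_iff)
  have pr_a: "pr t (a \<oplus>\<^bsub>A\<^esub> b) = pr t a \<oplus>\<^bsub>R\<^esub> pr t b" "r \<in> carrier R \<Longrightarrow> pr t (r \<odot>\<^bsub>A\<^esub> a) = r \<otimes>\<^bsub>R\<^esub> pr t a"
    if "t \<in> carrier T" "a \<in> carrier A" "b \<in> carrier A" for t a b r
    using pr that by (auto simp: bilinear_pairing_def mod_hom_def self_module_def)
  have pr_t: "pr (t \<oplus>\<^bsub>T\<^esub> u) a = pr t a \<oplus>\<^bsub>R\<^esub> pr u a" "r \<in> carrier R \<Longrightarrow> pr (r \<odot>\<^bsub>T\<^esub> t) a = r \<otimes>\<^bsub>R\<^esub> pr t a"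
    if "t \<in> carrier T" "u \<in> carrier T" "a \<in> carrier A" for t u a r
    using pr that by (auto simp: bilinear_pairing_def mod_hom_def self_module_def)
  have v: "v ` (carrier M \<times> carrier T) \<subseteq> carrier ?H"
    by (auto simp: v_def hom_module_def mod_hom_def prc pr_a M.smult_l_distr M.smult_assoc1)
  obtain h where h: "h \<in> hom ?F ?H" and hv: "\<And>x. x \<in> carrier M \<times> carrier T \<Longrightarrow> h (frag_of x) = v x"
    using H.free_Abelian_group_universal [OF v] by blast
  interpret h: group_hom ?F ?H h
    by (intro group_hom.intro group_hom_axioms.intro h F.is_group H.is_group)
  have hdiff: "h (x - y) = h x \<otimes>\<^bsub>?H\<^esub> inv\<^bsub>?H\<^esub> h y"
    if "x \<in> carrier ?F" "y \<in> carrier ?F" for x y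
  proof -
    have "x - y = x \<otimes>\<^bsub>?F\<^esub> inv\<^bsub>?F\<^esub> y" using that by simp
    then show ?thesis using that by (metis h.hom_mult h.hom_inv F.inv_closed)
  qed
  have add_H: "f \<oplus>\<^bsub>hom_module R A M\<^esub> g = (\<lambda>a\<in>carrier A. f a \<oplus>\<^bsub>M\<^esub> g a)" for f g
    by (simp add: hom_module_def)
  have ker_diff: "x - y \<in> kernel ?F ?H h"
    if "x \<in> carrier ?F" "y \<in> carrier ?F" "h x = h y" for x y
  proof -
    have "h (x - y) = \<one>\<^bsub>?H\<^esub>"
      unfolding hdiff [OF that(1,2)] that(3) by (rule H.r_inv [OF h.hom_closed [OF that(2)]])
    moreover have "x - y \<in> carrier ?F"
      using that(1,2) keys_diff [of x y] by auto
    ultimately show ?thesis by (simp add: kernel_def)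
  qed
  have ker_add: "x - y - z \<in> kernel ?F ?H h"
    if "x \<in> carrier ?F" "y \<in> carrier ?F" "z \<in> carrier ?F" "h x = h y \<otimes>\<^bsub>?H\<^esub> h z" for x y z
  proof -
    have "y + z \<in> carrier ?F" "h (y + z) = h y \<otimes>\<^bsub>?H\<^esub> h z"
      using F.m_closed [OF that(2,3)] h.hom_mult [OF that(2,3)] by simp_all
    then show ?thesis using ker_diff [of x "y + z"] that by (simp add: diff_diff_eq)
  qed
  have "tensor_relations R M T \<subseteq> kernel ?F ?H h"
  proof -
    have k1: "frag_of (m \<oplus>\<^bsub>M\<^esub> m', t) - frag_of (m, t) - frag_of (m', t) \<in> kernel ?F ?H h"
      if "m \<in> carrier M" "m' \<in> carrier M" "t \<in> carrier T" for m m' t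
      by (rule ker_add)
        (use that in \<open>auto simp: hv v_def add_H prc fun_eq_iff restrict_def M.smult_r_distr\<close>)
    have k2: "frag_of (m, t \<oplus>\<^bsub>T\<^esub> t') - frag_of (m, t) - frag_of (m, t') \<in> kernel ?F ?H h"
      if "m \<in> carrier M" "t \<in> carrier T" "t' \<in> carrier T" for m t t'
      by (rule ker_add)
        (use that in \<open>auto simp: hv v_def add_H prc pr_t fun_eq_iff restrict_def M.smult_l_distr\<close>)
    have k3: "frag_of (r \<odot>\<^bsub>M\<^esub> m, t) - frag_of (m, r \<odot>\<^bsub>T\<^esub> t) \<in> kernel ?F ?H h"
      if "r \<in> carrier R" "m \<in> carrier M" "t \<in> carrier T" for r m t
      by (rule ker_diff)
        (use that in \<open>auto simp: hv v_def prc pr_t fun_eq_iff restrict_def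
          M.smult_assoc1 [symmetric] M.R.m_comm\<close>)
    show ?thesis
      unfolding tensor_relations_def
      by (intro Un_least subsetI; elim CollectE exE conjE; hypsubst)
        (erule k1 k2 k3; assumption)+
  qed
  then have "?K \<subseteq> kernel ?F ?H h"
    unfolding tensor_kernel_def
    using F.generate_subgroup_incl h.subgroup_kernel by blast
  then obtain g where g: "g \<in> hom (?F Mod ?K) ?H"
      and gh: "\<And>x. x \<in> carrier ?F \<Longrightarrow> g (?K #>\<^bsub>?F\<^esub> x) = h x"
    using h.FactGroup_universal_kernel [OF norm] by blast
  interpret Q: group "tensor_product R M T"
    unfolding tensor_product_def by (rule normal.factorgroup_is_group [OF norm])
  show ?thesis
  proof (rule ex1I)
    let ?\<alpha> = "restrict g (carrier (tensor_product R M T))"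
    have "?\<alpha> \<in> hom (tensor_product R M T) ?H"
      using g Q.m_closed by (auto simp: hom_def tensor_product_def)
    moreover have "?\<alpha> (pure_tensor R M T m t) = (\<lambda>a\<in>carrier A. pr t a \<odot>\<^bsub>M\<^esub> m)"
      if "m \<in> carrier M" "t \<in> carrier T" for m t
      using that by (auto simp: carT pure_tensor_def gh hv v_def)
    ultimately show "is_alpha_map R T A pr M ?\<alpha>"
      by (simp add: is_alpha_map_def)
  next
    fix \<alpha> assume \<alpha>: "is_alpha_map R T A pr M \<alpha>"
    interpret al: group_hom "tensor_product R M T" ?H \<alpha>
      by (intro group_hom.intro group_hom_axioms.intro Q.is_group H.is_group)
        (use \<alpha> in \<open>simp add: is_alpha_map_def\<close>)
    have piH: "(\<lambda>x. ?K #>\<^bsub>?F\<^esub> x) \<in> hom ?F (tensor_product R M T)"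
      unfolding tensor_product_def by (rule normal.r_coset_hom_Mod [OF norm])
    then have "(\<lambda>x. \<alpha> (?K #>\<^bsub>?F\<^esub> x)) \<in> hom ?F ?H"
      using Group.hom_compose [OF piH al.homh] by (simp add: o_def)
    then interpret c: group_hom ?F ?H "\<lambda>x. \<alpha> (?K #>\<^bsub>?F\<^esub> x)"
      by (intro group_hom.intro group_hom_axioms.intro F.is_group H.is_group)
    have cdiff: "\<alpha> (?K #>\<^bsub>?F\<^esub> (x - y)) = \<alpha> (?K #>\<^bsub>?F\<^esub> x) \<otimes>\<^bsub>?H\<^esub> inv\<^bsub>?H\<^esub> \<alpha> (?K #>\<^bsub>?F\<^esub> y)"
      if "x \<in> carrier ?F" "y \<in> carrier ?F" for x y
    proof -
      have "x - y = x \<otimes>\<^bsub>?F\<^esub> inv\<^bsub>?F\<^esub> y" using that by simp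
      then show ?thesis using that by (metis c.hom_mult c.hom_inv F.inv_closed)
    qed
    have eq: "\<alpha> (?K #>\<^bsub>?F\<^esub> x) = h x" if "Poly_Mapping.keys x \<subseteq> carrier M \<times> carrier T" for x
    proof (rule free_Abelian_group_induct [OF that])
      show "\<alpha> (?K #>\<^bsub>?F\<^esub> 0) = h 0"
        using c.hom_one h.hom_one by simp
      show "\<alpha> (?K #>\<^bsub>?F\<^esub> (x - y)) = h (x - y)"
        if "Poly_Mapping.keys x \<subseteq> carrier M \<times> carrier T"
          "Poly_Mapping.keys y \<subseteq> carrier M \<times> carrier T"
          "\<alpha> (?K #>\<^bsub>?F\<^esub> x) = h x" "\<alpha> (?K #>\<^bsub>?F\<^esub> y) = h y" for x y
        using that by (simp add: cdiff hdiff)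
      show "\<alpha> (?K #>\<^bsub>?F\<^esub> frag_of p) = h (frag_of p)" if "p \<in> carrier M \<times> carrier T" for p
        using \<alpha> that by (auto simp: is_alpha_map_def pure_tensor_def hv v_def)
    qed
    show "\<alpha> = restrict g (carrier (tensor_product R M T))"
    proof (rule extensionalityI)
      show "\<alpha> \<in> extensional (carrier (tensor_product R M T))"
        using \<alpha> by (simp add: is_alpha_map_def)
    qed (auto simp: carT eq gh)
  qed
qed

end

theory Submission
  imports Defs
begin

text \<open>
  The annihilator of a functional \<open>f\<close> is the left ideal of all \<open>x\<close> with \<open>f (b x) = 0\<close> for every
  \<open>b\<close>, and \<open>A / Ann f\<close> is isomorphic to \<open>A f\<close>.  Given finitely many \<open>f\<close> in the finite dual,
  noetherianity makes \<open>A / I\<close> finitely generated for the intersection \<open>I\<close> of their annihilators,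
  and property P yields a left ideal \<open>J \<subseteq> I\<close> with \<open>A / J\<close> finitely generated projective.  A dual basis
  of \<open>A / J\<close> gives \<open>p s \<in> A\<close> and functionals \<open>c s\<close> vanishing on \<open>J\<close> with \<open>f = (\<Sum>s. f (p s) c s)\<close>.
  Since \<open>J\<close> is a left ideal, it lies in the annihilator of \<open>c s\<close>, so \<open>c s\<close> is again in the finite dual.
  Hence every tensor \<open>u\<close> built from the given \<open>f\<close> is recovered from its image under \<open>\<alpha>\<close> as
  \<open>u = (\<Sum>s. \<alpha> u (p s) \<otimes> c s)\<close>.
\<close>

section \<open>Finite generation modulo a submodule\<close>

text \<open>If \<open>X\<close> is not contained in \<open>carrier M\<close>, no submodule contains
  it and the intersection is \<open>UNIV\<close>; spans are therefore only formed of subsets of the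
  carrier.\<close>

definition lin_span ::
    "('r, 'x) ring_scheme \<Rightarrow> ('r, 'm, 'y) module_scheme \<Rightarrow> 'm set \<Rightarrow> 'm set" where
  "lin_span R M X = \<Inter>{H. submodule H R M \<and> X \<subseteq> H}"

text \<open>Finite generation of \<open>M / I\<close>, phrased inside \<open>M\<close>. For
  submodules of one fixed module this avoids comparing different coset spaces;
  \<open>fin_gen_quot_iff\<close> and \<open>finite_dual_iff\<close> translate.\<close>

definition fin_gen_over ::
    "('r, 'x) ring_scheme \<Rightarrow> ('r, 'm, 'y) module_scheme \<Rightarrow> 'm set \<Rightarrow> bool" where
  "fin_gen_over R M I \<longleftrightarrow>
     (\<exists>S. finite S \<and> S \<subseteq> carrier M \<and> lin_span R M (S \<union> I) = carrier M)"

lemma lin_span_superset: "X \<subseteq> lin_span R M X"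
  by (auto simp: lin_span_def)

lemma lin_span_minimal: "submodule H R M \<Longrightarrow> X \<subseteq> H \<Longrightarrow> lin_span R M X \<subseteq> H"
  by (auto simp: lin_span_def)

lemma lin_span_mono: "X \<subseteq> Y \<Longrightarrow> lin_span R M X \<subseteq> lin_span R M Y"
  by (auto simp: lin_span_def)

context module
begin

lemma zero_in_submodule: "submodule H R M \<Longrightarrow> \<zero>\<^bsub>M\<^esub> \<in> H"
  using subgroup.one_closed [OF submodule.axioms(1)] by fastforce

lemma submodule_diff:
  assumes "submodule H R M" "x \<in> H" "y \<in> H"
  shows "x \<ominus>\<^bsub>M\<^esub> y \<in> H"
  using submoduleE(3,5) [OF assms(1)] assms(2,3) by (simp add: a_minus_def)

lemma submodule_Inter:
  assumes "\<H> \<noteq> {}" "\<And>H. H \<in> \<H> \<Longrightarrow> submodule H R M"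
  shows "submodule (\<Inter>\<H>) R M"
proof (rule submoduleI)
  show "\<Inter>\<H> \<subseteq> carrier M" using assms(1) submoduleE(1) [OF assms(2)] by blast
  show "\<zero>\<^bsub>M\<^esub> \<in> \<Inter>\<H>" using zero_in_submodule [OF assms(2)] by auto
qed (use submoduleE(3-5) [OF assms(2)] in auto)

lemma lin_span_submodule:
  assumes "X \<subseteq> carrier M"
  shows "submodule (lin_span R M X) R M"
  unfolding lin_span_def
  by (rule submodule_Inter) (use assms carrier_is_submodule in auto)

lemma lin_span_of_submodule: "submodule H R M \<Longrightarrow> lin_span R M H = H"
  by (simp add: lin_span_minimal lin_span_superset subset_antisym)

text \<open>The multiples of \<open>s\<close> plus elements of the span of \<open>X\<close> already
  form a submodule containing \<open>insert s X\<close>, so minimality of the span applies.\<close>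

lemma lin_span_insert_cases:
  assumes s: "s \<in> carrier M" and X: "X \<subseteq> carrier M" and x: "x \<in> lin_span R M (insert s X)"
  obtains r y where "r \<in> carrier R" "y \<in> lin_span R M X" "x = r \<odot>\<^bsub>M\<^esub> s \<oplus>\<^bsub>M\<^esub> y"
proof -
  let ?L = "lin_span R M X"
  let ?H = "{r \<odot>\<^bsub>M\<^esub> s \<oplus>\<^bsub>M\<^esub> y |r y. r \<in> carrier R \<and> y \<in> ?L}"
  have L: "submodule ?L R M" by (rule lin_span_submodule [OF X])
  note LE = submoduleE [OF L] and L0 = zero_in_submodule [OF L]
  have Lc: "y \<in> carrier M" if "y \<in> ?L" for y using that LE(1) by blast
  have "submodule ?H R M"
  proof (rule submoduleI)
    show "?H \<subseteq> carrier M" using s LE(1) by auto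
    show "\<zero>\<^bsub>M\<^esub> \<in> ?H"
      using s L0 by (intro CollectI exI [of _ \<zero>] exI [of _ "\<zero>\<^bsub>M\<^esub>"]) simp
  next
    fix a assume "a \<in> ?H"
    then obtain r y where ry: "r \<in> carrier R" "y \<in> ?L" "a = r \<odot>\<^bsub>M\<^esub> s \<oplus>\<^bsub>M\<^esub> y" by blast
    then show "\<ominus>\<^bsub>M\<^esub> a \<in> ?H"
      using s LE(3) Lc
      by (intro CollectI exI [of _ "\<ominus> r"] exI [of _ "\<ominus>\<^bsub>M\<^esub> y"]) (simp add: M.minus_add smult_l_minus)
    show "t \<odot>\<^bsub>M\<^esub> a \<in> ?H" if t: "t \<in> carrier R" for t
      using s ry LE(4) Lc t
      by (intro CollectI exI [of _ "t \<otimes> r"] exI [of _ "t \<odot>\<^bsub>M\<^esub> y"])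
        (simp add: smult_r_distr smult_assoc1)
    fix b assume "b \<in> ?H"
    then obtain r' y' where "r' \<in> carrier R" "y' \<in> ?L" "b = r' \<odot>\<^bsub>M\<^esub> s \<oplus>\<^bsub>M\<^esub> y'" by blast
    then show "a \<oplus>\<^bsub>M\<^esub> b \<in> ?H"
      using s ry LE(5) Lc
      by (intro CollectI exI [of _ "r \<oplus> r'"] exI [of _ "y \<oplus>\<^bsub>M\<^esub> y'"])
        (simp add: smult_l_distr M.add.m_ac)
  qed
  moreover have "insert s X \<subseteq> ?H"
  proof -
    have "s = \<one> \<odot>\<^bsub>M\<^esub> s \<oplus>\<^bsub>M\<^esub> \<zero>\<^bsub>M\<^esub>" using s by simp
    moreover have "x = \<zero> \<odot>\<^bsub>M\<^esub> s \<oplus>\<^bsub>M\<^esub> x" if "x \<in> X" for x using s X that by auto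
    ultimately show ?thesis using L0 lin_span_superset [of X R M] by blast
  qed
  ultimately have "x \<in> ?H" using x lin_span_minimal by blast
  then show thesis using that by blast
qed

text \<open>Hilbert's leading-coefficient ideal, used for the coefficient of a new generator.\<close>
lemma transporter_ideal:
  assumes L: "submodule L R M" and N: "submodule N R M" and s: "s \<in> carrier M"
  shows "ideal {r \<in> carrier R. \<exists>y\<in>L. r \<odot>\<^bsub>M\<^esub> s \<oplus>\<^bsub>M\<^esub> y \<in> N} R" (is "ideal ?J R")
proof (rule idealI)
  note LE = submoduleE [OF L] and NE = submoduleE [OF N]
  have Lc: "y \<in> carrier M" if "y \<in> L" for y using that LE(1) by blast
  show "ring R" by (rule R.ring_axioms)
  have mult: "t \<otimes> r \<in> ?J" if r: "r \<in> ?J" and t: "t \<in> carrier R" for t r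
  proof -
    from r obtain y where y: "y \<in> L" "r \<odot>\<^bsub>M\<^esub> s \<oplus>\<^bsub>M\<^esub> y \<in> N" "r \<in> carrier R" by blast
    then have "t \<odot>\<^bsub>M\<^esub> (r \<odot>\<^bsub>M\<^esub> s \<oplus>\<^bsub>M\<^esub> y) \<in> N" using NE(4) t by blast
    then have "(t \<otimes> r) \<odot>\<^bsub>M\<^esub> s \<oplus>\<^bsub>M\<^esub> t \<odot>\<^bsub>M\<^esub> y \<in> N"
      using y s t Lc by (simp add: smult_r_distr smult_assoc1)
    then show ?thesis using LE(4) y t by blast
  qed
  show "t \<otimes> r \<in> ?J" if "r \<in> ?J" "t \<in> carrier R" for r t
    by (rule mult [OF that])
  show "r \<otimes> t \<in> ?J" if "r \<in> ?J" "t \<in> carrier R" for r t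
    using mult [OF that] R.m_comm [of r t] that by simp
  show "subgroup ?J (add_monoid R)"
  proof (rule R.add.subgroupI)
    have "\<zero> \<odot>\<^bsub>M\<^esub> s \<oplus>\<^bsub>M\<^esub> \<zero>\<^bsub>M\<^esub> \<in> N" using s zero_in_submodule [OF N] by simp
    then show "?J \<noteq> {}" using zero_in_submodule [OF L] by blast
  next
    fix a assume a: "a \<in> ?J"
    have "\<ominus> \<one> \<otimes> a \<in> ?J" by (rule mult [OF a]) simp
    moreover have "\<ominus> \<one> \<otimes> a = \<ominus> a" using a by (simp add: R.l_minus)
    ultimately show "\<ominus> a \<in> ?J" by simp
    fix b assume "b \<in> ?J"
    then obtain z where z: "z \<in> L" "b \<odot>\<^bsub>M\<^esub> s \<oplus>\<^bsub>M\<^esub> z \<in> N" "b \<in> carrier R" by blast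
    obtain y where y: "y \<in> L" "a \<odot>\<^bsub>M\<^esub> s \<oplus>\<^bsub>M\<^esub> y \<in> N" "a \<in> carrier R" using a by blast
    have "(a \<oplus> b) \<odot>\<^bsub>M\<^esub> s \<oplus>\<^bsub>M\<^esub> (y \<oplus>\<^bsub>M\<^esub> z) = (a \<odot>\<^bsub>M\<^esub> s \<oplus>\<^bsub>M\<^esub> y) \<oplus>\<^bsub>M\<^esub> (b \<odot>\<^bsub>M\<^esub> s \<oplus>\<^bsub>M\<^esub> z)"
      using y z s Lc by (simp add: smult_l_distr M.add.m_ac)
    also have "\<dots> \<in> N" using NE(5) y z by blast
    finally have "(a \<oplus> b) \<odot>\<^bsub>M\<^esub> s \<oplus>\<^bsub>M\<^esub> (y \<oplus>\<^bsub>M\<^esub> z) \<in> N" .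
    then show "a \<oplus> b \<in> ?J" using LE(5) y z by auto
  qed auto
qed

text \<open>Relative form of the theorem that submodules of finitely generated modules over a
  noetherian ring are finitely generated: everything is counted modulo \<open>I\<close>. Induction
  on \<open>S\<close>: the coefficients at a new generator \<open>s\<close> of elements of
  \<open>H\<close> form a finitely generated ideal, and what remains after matching them lies in the
  span of the old generators.\<close>

lemma noetherian_submodule_fin_gen:
  assumes noeth: "noetherian_ring R" and I: "submodule I R M"
    and S: "finite S" "S \<subseteq> carrier M"
    and H: "submodule H R M" "H \<subseteq> lin_span R M (S \<union> I)"
  shows "\<exists>T. finite T \<and> T \<subseteq> H \<and> H \<subseteq> lin_span R M (T \<union> (H \<inter> I))"
  using S H
proof (induction S arbitrary: H rule: finite_induct)
  case empty
  then have "H \<subseteq> lin_span R M ({} \<union> (H \<inter> I))"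
    using lin_span_of_submodule [OF I] lin_span_superset [of H R M]
    by (simp add: Int_absorb2)
  then show ?case by blast
next
  case (insert s S)
  interpret noetherian_ring R by (rule noeth)
  let ?L = "lin_span R M (S \<union> I)"
  have s: "s \<in> carrier M" and SI: "S \<union> I \<subseteq> carrier M"
    using insert.prems(1) submoduleE(1) [OF I] by auto
  have L: "submodule ?L R M" by (rule lin_span_submodule [OF SI])
  note H = insert.prems(2)
  have Hc: "H \<subseteq> carrier M" and Lc: "?L \<subseteq> carrier M" using submoduleE(1) H L by blast+
  have HL: "submodule (H \<inter> ?L) R M"
    using submodule_Inter [of "{H, ?L}"] H L by auto
  obtain T where T: "finite T" "T \<subseteq> H \<inter> ?L" "H \<inter> ?L \<subseteq> lin_span R M (T \<union> (H \<inter> ?L \<inter> I))"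
    using insert.IH [OF _ HL] insert.prems(1) by blast
  \<comment> \<open>The target \<open>N\<close> is kept variable, since the coefficient ideal of
    \<open>H\<close> is to be compared with that of a finitely generated submodule of
    \<open>H\<close>.\<close>
  let ?J = "\<lambda>N. {r \<in> carrier R. \<exists>y\<in>?L. r \<odot>\<^bsub>M\<^esub> s \<oplus>\<^bsub>M\<^esub> y \<in> N}"
  obtain G where G: "G \<subseteq> carrier R" "finite G" "?J H = Idl G"
    using finetely_gen [OF transporter_ideal [OF L H s]] by blast
  have "G \<subseteq> ?J H" using G genideal_self by auto
  then have "\<forall>g\<in>G. \<exists>y\<in>?L. g \<odot>\<^bsub>M\<^esub> s \<oplus>\<^bsub>M\<^esub> y \<in> H" by blast
  then obtain y where y: "\<And>g. g \<in> G \<Longrightarrow> y g \<in> ?L \<and> g \<odot>\<^bsub>M\<^esub> s \<oplus>\<^bsub>M\<^esub> y g \<in> H" by metis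
  \<comment> \<open>Every generator of the coefficient ideal is lifted to an element of
    \<open>H\<close> with that coefficient at \<open>s\<close>.\<close>
  define T' where "T' = (\<lambda>g. g \<odot>\<^bsub>M\<^esub> s \<oplus>\<^bsub>M\<^esub> y g) ` G"
  have T': "finite T'" "T' \<subseteq> H" using G y by (auto simp: T'_def)
  have N: "submodule (lin_span R M T') R M"
    using T' Hc by (intro lin_span_submodule) auto
  have "g \<odot>\<^bsub>M\<^esub> s \<oplus>\<^bsub>M\<^esub> y g \<in> lin_span R M T'" if "g \<in> G" for g
    using that lin_span_superset [of T' R M] by (auto simp: T'_def)
  \<comment> \<open>Since \<open>T'\<close> realizes all generators of the ideal, each coefficient
    that occurs in \<open>H\<close> already occurs in the span of \<open>T'\<close>.\<close>
  then have "G \<subseteq> ?J (lin_span R M T')"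
    using G(1) y by blast
  then have J: "?J H \<subseteq> ?J (lin_span R M T')"
    unfolding G(3) by (rule genideal_minimal [OF transporter_ideal [OF L N s]])
  let ?U = "T \<union> T' \<union> (H \<inter> I)"
  have U: "submodule (lin_span R M ?U) R M"
    using T T' Hc by (intro lin_span_submodule) auto
  have "H \<subseteq> lin_span R M ?U"
  proof
    fix x assume x: "x \<in> H"
    then have "x \<in> lin_span R M (insert s (S \<union> I))" using insert.prems(3) by auto
    then obtain r z where r: "r \<in> carrier R" and z: "z \<in> ?L" and xz: "x = r \<odot>\<^bsub>M\<^esub> s \<oplus>\<^bsub>M\<^esub> z"
      by (rule lin_span_insert_cases [OF s SI])
    then have "r \<in> ?J H" using x by auto
    \<comment> \<open>This element of the span of \<open>T'\<close> has the same coefficient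
      \<open>r\<close> as \<open>x\<close>. Subtracting it cancels \<open>s\<close> and leaves an
      element of \<open>H\<close> in \<open>?L\<close>, which the induction hypothesis
      covers.\<close>
    then obtain w where w: "w \<in> ?L" and rw: "r \<odot>\<^bsub>M\<^esub> s \<oplus>\<^bsub>M\<^esub> w \<in> lin_span R M T'" using J by blast
    have rwH: "r \<odot>\<^bsub>M\<^esub> s \<oplus>\<^bsub>M\<^esub> w \<in> H" using rw lin_span_minimal [OF H T'(2)] by blast
    have zc: "z \<in> carrier M" and wc: "w \<in> carrier M" using z w Lc by auto
    have rsc: "r \<odot>\<^bsub>M\<^esub> s \<in> carrier M" using r s by simp
    have "w \<oplus>\<^bsub>M\<^esub> (z \<ominus>\<^bsub>M\<^esub> w) = z"
      using M.a_lcomm [OF wc zc M.a_inv_closed [OF wc]] zc wc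
      by (simp add: a_minus_def M.r_neg)
    then have xdec: "x = (r \<odot>\<^bsub>M\<^esub> s \<oplus>\<^bsub>M\<^esub> w) \<oplus>\<^bsub>M\<^esub> (z \<ominus>\<^bsub>M\<^esub> w)"
      using zc wc rsc by (simp add: xz M.a_assoc)
    also have "\<dots> = (z \<ominus>\<^bsub>M\<^esub> w) \<oplus>\<^bsub>M\<^esub> (r \<odot>\<^bsub>M\<^esub> s \<oplus>\<^bsub>M\<^esub> w)"
      using zc wc rsc by (intro M.a_comm) auto
    finally have "x \<ominus>\<^bsub>M\<^esub> (r \<odot>\<^bsub>M\<^esub> s \<oplus>\<^bsub>M\<^esub> w) = z \<ominus>\<^bsub>M\<^esub> w"
      using M.minus_closed [OF zc wc] M.a_closed [OF rsc wc]
      by (simp add: a_minus_def [of M _ "_ \<oplus>\<^bsub>M\<^esub> _"] M.a_assoc M.r_neg)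
    then have "z \<ominus>\<^bsub>M\<^esub> w \<in> H \<inter> ?L"
      using submodule_diff [OF H x rwH] submodule_diff [OF L z w] by simp
    also have "\<dots> \<subseteq> lin_span R M ?U"
      by (rule subset_trans [OF T(3) lin_span_mono]) auto
    finally have "z \<ominus>\<^bsub>M\<^esub> w \<in> lin_span R M ?U" .
    moreover have "r \<odot>\<^bsub>M\<^esub> s \<oplus>\<^bsub>M\<^esub> w \<in> lin_span R M ?U"
      using rw lin_span_mono [of T' ?U R M] by blast
    ultimately show "x \<in> lin_span R M ?U"
      using submoduleE(5) [OF U] xdec by metis
  qed
  then show ?case using T T' by (intro exI [of _ "T \<union> T'"]) auto
qed

lemma fin_gen_over_mono:
  assumes "fin_gen_over R M I" "I \<subseteq> J" "J \<subseteq> carrier M"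
  shows "fin_gen_over R M J"
proof -
  obtain S where S: "finite S" "S \<subseteq> carrier M" "lin_span R M (S \<union> I) = carrier M"
    using assms(1) by (auto simp: fin_gen_over_def)
  have "carrier M \<subseteq> lin_span R M (S \<union> J)"
    unfolding S(3) [symmetric] by (rule lin_span_mono) (use assms(2) in auto)
  moreover have "lin_span R M (S \<union> J) \<subseteq> carrier M"
    using assms(3) S(2) by (intro lin_span_minimal carrier_is_submodule) auto
  ultimately show ?thesis using S unfolding fin_gen_over_def by blast
qed

text \<open>The quotient \<open>I / (I \<inter> J)\<close> embeds into \<open>M / J\<close> and is
  finitely generated by noetherianity. Its generators \<open>T\<close>, joined to generators
  \<open>S\<close> of \<open>M\<close> modulo \<open>I\<close>, generate \<open>M\<close> modulo
  \<open>I \<inter> J\<close>.\<close>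

lemma fin_gen_over_Int:
  assumes noeth: "noetherian_ring R" and I: "submodule I R M" and J: "submodule J R M"
    and "fin_gen_over R M I" "fin_gen_over R M J"
  shows "fin_gen_over R M (I \<inter> J)"
proof -
  obtain S S' where S: "finite S" "S \<subseteq> carrier M" "lin_span R M (S \<union> I) = carrier M"
      and S': "finite S'" "S' \<subseteq> carrier M" "lin_span R M (S' \<union> J) = carrier M"
    using assms(4,5) by (auto simp: fin_gen_over_def)
  obtain T where T: "finite T" "T \<subseteq> I" "I \<subseteq> lin_span R M (T \<union> (I \<inter> J))"
    using noetherian_submodule_fin_gen [OF noeth J S'(1,2) I] S'(3) submoduleE(1) [OF I] by blast
  let ?L = "lin_span R M (S \<union> T \<union> (I \<inter> J))"
  have sub: "S \<union> T \<union> (I \<inter> J) \<subseteq> carrier M"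
    using S T submoduleE(1) [OF I] by auto
  have L: "submodule ?L R M" by (rule lin_span_submodule [OF sub])
  have "I \<subseteq> ?L" by (rule subset_trans [OF T(3) lin_span_mono]) auto
  then have "S \<union> I \<subseteq> ?L" using lin_span_superset [of "S \<union> T \<union> (I \<inter> J)" R M] by auto
  then have "carrier M \<subseteq> ?L" unfolding S(3) [symmetric] by (rule lin_span_minimal [OF L])
  then have "?L = carrier M" using submoduleE(1) [OF L] by blast
  then show ?thesis
    unfolding fin_gen_over_def using S(1,2) T(1,2) sub
    by (intro exI [of _ "S \<union> T"]) auto
qed

text \<open>The factor \<open>carrier M\<close> makes the intersection over the empty family equal
  to \<open>M\<close> instead of \<open>UNIV\<close>.\<close>

lemma fin_gen_over_Inter:
  assumes noeth: "noetherian_ring R" and "finite F"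
    and "\<And>f. f \<in> F \<Longrightarrow> submodule (I f) R M" "\<And>f. f \<in> F \<Longrightarrow> fin_gen_over R M (I f)"
  shows "submodule (carrier M \<inter> (\<Inter>f\<in>F. I f)) R M \<and> fin_gen_over R M (carrier M \<inter> (\<Inter>f\<in>F. I f))"
  using assms(2-)
proof (induction F rule: finite_induct)
  case empty
  have "fin_gen_over R M (carrier M)"
    unfolding fin_gen_over_def
    by (intro exI [of _ "{}"]) (simp add: lin_span_of_submodule carrier_is_submodule)
  then show ?case using carrier_is_submodule by simp
next
  case (insert g F)
  have eq: "carrier M \<inter> (\<Inter>f\<in>insert g F. I f) = I g \<inter> (carrier M \<inter> (\<Inter>f\<in>F. I f))"
    by auto
  have IH: "submodule (carrier M \<inter> (\<Inter>f\<in>F. I f)) R M" "fin_gen_over R M (carrier M \<inter> (\<Inter>f\<in>F. I f))"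
    using insert by auto
  show ?case
    unfolding eq using submodule_Inter [of "{I g, carrier M \<inter> (\<Inter>f\<in>F. I f)}"] IH insert.prems
    by (auto intro!: fin_gen_over_Int [OF noeth])
qed

end

section \<open>Surjective linear maps and finite generation of their images\<close>

locale module_epi = module R M
    for R :: "('r, 'x) ring_scheme" (structure) and M :: "('r, 'm, 'y) module_scheme" (structure) +
  fixes N :: "('r, 'n, 'z) module_scheme" and h :: "'m \<Rightarrow> 'n"
  assumes image: "h ` carrier M = carrier N"
    and hom_zero: "h \<zero>\<^bsub>M\<^esub> = \<zero>\<^bsub>N\<^esub>"
    and hom_add: "\<lbrakk>x \<in> carrier M; y \<in> carrier M\<rbrakk> \<Longrightarrow> h (x \<oplus>\<^bsub>M\<^esub> y) = h x \<oplus>\<^bsub>N\<^esub> h y"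
    and hom_smult: "\<lbrakk>r \<in> carrier R; x \<in> carrier M\<rbrakk> \<Longrightarrow> h (r \<odot>\<^bsub>M\<^esub> x) = r \<odot>\<^bsub>N\<^esub> h x"
begin

text \<open>The locale asks only for a surjection compatible with the operations of
  \<open>N\<close>. All module axioms are transported from \<open>M\<close>, so quotients, orbits
  and images become modules without separate verification.\<close>

lemma codomain_module: "module R N"
proof -
  have clos: "h x \<in> carrier N" if "x \<in> carrier M" for x using that image by blast
  show ?thesis
  proof (rule moduleI)
    show "cring R" by (rule R.is_cring)
    show "abelian_group N"
    proof (rule abelian_groupI)
      show "\<zero>\<^bsub>N\<^esub> \<in> carrier N" using clos hom_zero by (metis M.zero_closed)
      fix x assume "x \<in> carrier N"
      then obtain a where a: "a \<in> carrier M" "x = h a" using image by blast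
      show "\<zero>\<^bsub>N\<^esub> \<oplus>\<^bsub>N\<^esub> x = x" using a by (metis hom_zero hom_add M.zero_closed M.l_zero)
      show "\<exists>y\<in>carrier N. y \<oplus>\<^bsub>N\<^esub> x = \<zero>\<^bsub>N\<^esub>"
        using a clos by (metis hom_zero hom_add M.a_inv_closed M.l_neg)
      fix y assume "y \<in> carrier N"
      then obtain b where b: "b \<in> carrier M" "y = h b" using image by blast
      show "x \<oplus>\<^bsub>N\<^esub> y \<in> carrier N" using a b clos by (metis hom_add M.a_closed)
      show "x \<oplus>\<^bsub>N\<^esub> y = y \<oplus>\<^bsub>N\<^esub> x" using a b by (metis hom_add M.a_comm)
      fix z assume "z \<in> carrier N"
      then obtain c where c: "c \<in> carrier M" "z = h c" using image by blast
      show "x \<oplus>\<^bsub>N\<^esub> y \<oplus>\<^bsub>N\<^esub> z = x \<oplus>\<^bsub>N\<^esub> (y \<oplus>\<^bsub>N\<^esub> z)"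
        using a b c by (simp add: M.a_assoc flip: hom_add)
    qed
  next
    fix r x assume r: "r \<in> carrier R" and "x \<in> carrier N"
    then obtain a where a: "a \<in> carrier M" "x = h a" using image by blast
    then show "r \<odot>\<^bsub>N\<^esub> x \<in> carrier N" using clos r by (metis hom_smult smult_closed)
    fix s assume s: "s \<in> carrier R"
    show "(r \<oplus> s) \<odot>\<^bsub>N\<^esub> x = r \<odot>\<^bsub>N\<^esub> x \<oplus>\<^bsub>N\<^esub> s \<odot>\<^bsub>N\<^esub> x"
      using a r s by (simp add: smult_l_distr flip: hom_add hom_smult)
    show "(r \<otimes> s) \<odot>\<^bsub>N\<^esub> x = r \<odot>\<^bsub>N\<^esub> (s \<odot>\<^bsub>N\<^esub> x)"
      using a r s by (simp add: smult_assoc1 flip: hom_add hom_smult)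
  next
    fix r x y assume r: "r \<in> carrier R" and "x \<in> carrier N" "y \<in> carrier N"
    then obtain a b where a: "a \<in> carrier M" "x = h a" and b: "b \<in> carrier M" "y = h b"
      using image by blast
    show "r \<odot>\<^bsub>N\<^esub> (x \<oplus>\<^bsub>N\<^esub> y) = r \<odot>\<^bsub>N\<^esub> x \<oplus>\<^bsub>N\<^esub> r \<odot>\<^bsub>N\<^esub> y"
      using a b r by (simp add: smult_r_distr flip: hom_add hom_smult)
  next
    fix x assume "x \<in> carrier N"
    then obtain a where a: "a \<in> carrier M" "x = h a" using image by blast
    then show "\<one> \<odot>\<^bsub>N\<^esub> x = x" by (metis hom_smult smult_one R.one_closed)
  qed
qed

sublocale N: module R N by (rule codomain_module)

lemma hom_closed: "x \<in> carrier M \<Longrightarrow> h x \<in> carrier N"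
  using image by blast

lemma hom_minus: "x \<in> carrier M \<Longrightarrow> h (\<ominus>\<^bsub>M\<^esub> x) = \<ominus>\<^bsub>N\<^esub> h x"
  by (metis M.a_inv_closed M.l_neg N.add.inv_equality hom_add hom_closed hom_zero a_inv_def)

lemma image_submodule:
  assumes L: "submodule L R M"
  shows "submodule (h ` L) R N"
proof (rule N.submoduleI)
  note LE = submoduleE [OF L]
  have Lc: "x \<in> carrier M" if "x \<in> L" for x using that LE(1) by blast
  show "h ` L \<subseteq> carrier N" using Lc hom_closed by blast
  show "\<zero>\<^bsub>N\<^esub> \<in> h ` L"
    unfolding hom_zero [symmetric] using zero_in_submodule [OF L] by (rule imageI)
  show "\<ominus>\<^bsub>N\<^esub> a \<in> h ` L" if "a \<in> h ` L" for a
    using that LE(3) Lc by (auto simp flip: hom_minus)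
  show "a \<oplus>\<^bsub>N\<^esub> b \<in> h ` L" if "a \<in> h ` L" "b \<in> h ` L" for a b
    using that LE(5) Lc by (auto simp flip: hom_add)
  show "r \<odot>\<^bsub>N\<^esub> b \<in> h ` L" if "r \<in> carrier R" "b \<in> h ` L" for r b
    using that LE(4) Lc by (auto simp flip: hom_smult)
qed

text \<open>Generators of \<open>N\<close> lift to \<open>M\<close>; every element of
  \<open>M\<close> then differs from an element of the span of the lifts and the kernel by a kernel
  element. Conversely, the preimage of a submodule of \<open>N\<close> containing the images of
  \<open>S\<close> contains both \<open>S\<close> and the kernel.\<close>

lemma fin_gen_iff:
  "fin_gen_module R N \<longleftrightarrow> fin_gen_over R M {x \<in> carrier M. h x = \<zero>\<^bsub>N\<^esub>}"
proof
  let ?K = "{x \<in> carrier M. h x = \<zero>\<^bsub>N\<^esub>}"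
  assume "fin_gen_module R N"
  then obtain S' where S': "finite S'" "S' \<subseteq> carrier N"
      and gen: "\<And>H. submodule H R N \<Longrightarrow> S' \<subseteq> H \<Longrightarrow> H = carrier N"
    unfolding fin_gen_module_def by blast
  obtain S where S: "finite S" "S \<subseteq> carrier M" "S' = h ` S"
    using finite_subset_image [OF S'(1), of h "carrier M"] S'(2) image by blast
  let ?L = "lin_span R M (S \<union> ?K)"
  have L: "submodule ?L R M" using S by (intro lin_span_submodule) auto
  have sup: "S \<union> ?K \<subseteq> ?L" by (rule lin_span_superset)
  note LE = submoduleE [OF L]
  have "submodule (h ` ?L) R N" by (rule image_submodule [OF L])
  then have hL: "h ` ?L = carrier N" using gen sup S(3) by blast
  have "carrier M \<subseteq> ?L"
  proof
    fix x assume x: "x \<in> carrier M"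
    then obtain y where y: "y \<in> ?L" "h x = h y" using hL hom_closed by blast
    have yc: "y \<in> carrier M" using y LE(1) by blast
    have "h (x \<ominus>\<^bsub>M\<^esub> y) = \<zero>\<^bsub>N\<^esub>"
      using x yc y by (simp add: a_minus_def hom_add hom_minus hom_closed N.r_neg)
    then have "x \<ominus>\<^bsub>M\<^esub> y \<in> ?L" using x yc sup by auto
    then have "(x \<ominus>\<^bsub>M\<^esub> y) \<oplus>\<^bsub>M\<^esub> y \<in> ?L" using LE(5) y by blast
    then show "x \<in> ?L" using x yc by (simp add: a_minus_def M.a_assoc M.l_neg)
  qed
  then show "fin_gen_over R M ?K"
    using S LE(1) unfolding fin_gen_over_def by blast
next
  let ?K = "{x \<in> carrier M. h x = \<zero>\<^bsub>N\<^esub>}"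
  assume "fin_gen_over R M ?K"
  then obtain S where S: "finite S" "S \<subseteq> carrier M" "lin_span R M (S \<union> ?K) = carrier M"
    by (auto simp: fin_gen_over_def)
  have "H = carrier N" if H: "submodule H R N" "h ` S \<subseteq> H" for H
  proof -
    note HE = N.submoduleE [OF H(1)] and H0 = N.zero_in_submodule [OF H(1)]
    let ?P = "{x \<in> carrier M. h x \<in> H}"
    have "submodule ?P R M"
      by (rule submoduleI) (use HE(3-5) H0 in \<open>auto simp: hom_zero hom_minus hom_add hom_smult\<close>)
    moreover have "S \<union> ?K \<subseteq> ?P" using H S H0 by auto
    ultimately have "lin_span R M (S \<union> ?K) \<subseteq> ?P" by (rule lin_span_minimal)
    then have "carrier M \<subseteq> ?P" by (simp only: S(3))
    then have "h ` carrier M \<subseteq> H" by auto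
    then show "H = carrier N" using image HE(1) by simp
  qed
  then show "fin_gen_module R N"
    unfolding fin_gen_module_def using S hom_closed by (intro exI [of _ "h ` S"]) auto
qed

end

section \<open>Quotients, duals and annihilators\<close>

lemma self_module_simps [simp]:
  "carrier (self_module R) = carrier R" "ring.add (self_module R) = ring.add R"
  "ring.zero (self_module R) = ring.zero R" "module.smult (self_module R) = monoid.mult R"
  by (simp_all add: self_module_def)

lemma hom_module_simps [simp]:
  "carrier (hom_module R M N) = mod_hom R M N"
  "g \<oplus>\<^bsub>hom_module R M N\<^esub> h = (\<lambda>x\<in>carrier M. g x \<oplus>\<^bsub>N\<^esub> h x)"
  "\<zero>\<^bsub>hom_module R M N\<^esub> = (\<lambda>x\<in>carrier M. \<zero>\<^bsub>N\<^esub>)"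
  "r \<odot>\<^bsub>hom_module R M N\<^esub> h = (\<lambda>x\<in>carrier M. r \<odot>\<^bsub>N\<^esub> h x)"
  by (simp_all add: hom_module_def)

lemma mod_hom_closed: "h \<in> mod_hom R M N \<Longrightarrow> x \<in> carrier M \<Longrightarrow> h x \<in> carrier N"
  and mod_hom_add: "h \<in> mod_hom R M N \<Longrightarrow> x \<in> carrier M \<Longrightarrow> y \<in> carrier M \<Longrightarrow>
    h (x \<oplus>\<^bsub>M\<^esub> y) = h x \<oplus>\<^bsub>N\<^esub> h y"
  and mod_hom_smult: "h \<in> mod_hom R M N \<Longrightarrow> r \<in> carrier R \<Longrightarrow> x \<in> carrier M \<Longrightarrow>
    h (r \<odot>\<^bsub>M\<^esub> x) = r \<odot>\<^bsub>N\<^esub> h x"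
  and mod_hom_extensional: "h \<in> mod_hom R M N \<Longrightarrow> h \<in> extensional (carrier M)"
  by (auto simp: mod_hom_def PiE_iff)

lemma mod_hom_restrictI:
  assumes "\<And>x. x \<in> carrier M \<Longrightarrow> h x \<in> carrier N"
    and "\<And>x y. x \<in> carrier M \<Longrightarrow> y \<in> carrier M \<Longrightarrow> h (x \<oplus>\<^bsub>M\<^esub> y) = h x \<oplus>\<^bsub>N\<^esub> h y"
    and "\<And>r x. r \<in> carrier R \<Longrightarrow> x \<in> carrier M \<Longrightarrow> h (r \<odot>\<^bsub>M\<^esub> x) = r \<odot>\<^bsub>N\<^esub> h x"
    and "module R M"
  shows "(\<lambda>x\<in>carrier M. h x) \<in> mod_hom R M N"
proof -
  interpret M: module R M by fact
  show ?thesis using assms(1-3) by (auto simp: mod_hom_def PiE_iff)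
qed

lemma mod_hom_zero:
  assumes "module R M" "module R N" "h \<in> mod_hom R M N"
  shows "h \<zero>\<^bsub>M\<^esub> = \<zero>\<^bsub>N\<^esub>"
proof -
  interpret M: module R M by fact
  interpret N: module R N by fact
  have "h (\<zero>\<^bsub>R\<^esub> \<odot>\<^bsub>M\<^esub> \<zero>\<^bsub>M\<^esub>) = \<zero>\<^bsub>R\<^esub> \<odot>\<^bsub>N\<^esub> h \<zero>\<^bsub>M\<^esub>"
    using assms(3) by (intro mod_hom_smult) auto
  then show ?thesis using mod_hom_closed [OF assms(3)] by simp
qed

lemma (in cring) module_self_module: "module R (self_module R)"
proof (rule moduleI)
  show "abelian_group (self_module R)"
    by (rule abelian_groupI) (auto simp: a_ac intro: l_neg a_inv_closed)
qed (simp_all add: is_cring l_distr r_distr m_assoc)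

text \<open>The additive half is \<open>comm_group_hom_module\<close>. Commutativity of
  \<open>R\<close> enters where a scalar multiple of a linear map must again be linear.\<close>

lemma module_hom_module:
  assumes A: "module R A" and M: "module R M"
  shows "module R (hom_module R A M)"
proof -
  interpret A: module R A by fact
  interpret M: module R M by fact
  show ?thesis
  proof (rule moduleI)
    show "cring R" by (rule A.R.is_cring)
    interpret comm_group "add_monoid (hom_module R A M)"
      by (rule comm_group_hom_module [OF A M])
    show "abelian_group (hom_module R A M)"
      using comm_group_axioms comm_monoid_axioms
      by (simp add: abelian_group_def abelian_group_axioms_def abelian_monoid_def)
  next
    fix r h assume r: "r \<in> carrier R" and h: "h \<in> carrier (hom_module R A M)"
    then have h': "h \<in> mod_hom R A M" by simp
    note hh = mod_hom_closed [OF h'] mod_hom_add [OF h'] mod_hom_smult [OF h']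
    show "r \<odot>\<^bsub>hom_module R A M\<^esub> h \<in> carrier (hom_module R A M)"
      unfolding hom_module_simps
      by (rule mod_hom_restrictI)
        (use r hh A in \<open>auto simp: M.smult_r_distr M.smult_assoc1 [symmetric] A.R.m_comm\<close>)
    fix s assume s: "s \<in> carrier R"
    show "(r \<oplus>\<^bsub>R\<^esub> s) \<odot>\<^bsub>hom_module R A M\<^esub> h =
        r \<odot>\<^bsub>hom_module R A M\<^esub> h \<oplus>\<^bsub>hom_module R A M\<^esub> s \<odot>\<^bsub>hom_module R A M\<^esub> h"
      using r s hh by (auto simp: fun_eq_iff M.smult_l_distr)
    show "(r \<otimes>\<^bsub>R\<^esub> s) \<odot>\<^bsub>hom_module R A M\<^esub> h = r \<odot>\<^bsub>hom_module R A M\<^esub> (s \<odot>\<^bsub>hom_module R A M\<^esub> h)"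
      using r s hh by (auto simp: fun_eq_iff M.smult_assoc1)
  next
    fix r g h assume r: "r \<in> carrier R" "g \<in> carrier (hom_module R A M)" "h \<in> carrier (hom_module R A M)"
    then show "r \<odot>\<^bsub>hom_module R A M\<^esub> (g \<oplus>\<^bsub>hom_module R A M\<^esub> h) =
        r \<odot>\<^bsub>hom_module R A M\<^esub> g \<oplus>\<^bsub>hom_module R A M\<^esub> r \<odot>\<^bsub>hom_module R A M\<^esub> h"
      using mod_hom_closed [of g R A M] mod_hom_closed [of h R A M]
      by (auto simp: fun_eq_iff M.smult_r_distr)
  next
    fix h assume "h \<in> carrier (hom_module R A M)"
    then have h: "h \<in> mod_hom R A M" by simp
    then show "\<one>\<^bsub>R\<^esub> \<odot>\<^bsub>hom_module R A M\<^esub> h = h"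
      using mod_hom_closed [OF h] mod_hom_extensional [OF h]
      by (auto simp: fun_eq_iff extensional_def)
  qed
qed

section \<open>Quotient modules as images of the coset map\<close>

lemma (in module) submodule_abelian_subgroup:
  assumes "submodule I R M"
  shows "abelian_subgroup I M"
  using assms M.abelian_group_axioms
  by (auto intro!: abelian_subgroupI3 additive_subgroup.intro simp: submodule_def)

lemma (in module) quot_module_epi:
  assumes I: "submodule I R M"
  shows "module_epi R M (quot_module M I) (\<lambda>x. I +>\<^bsub>M\<^esub> x)"
proof -
  interpret I: abelian_subgroup I M by (rule submodule_abelian_subgroup [OF I])
  show ?thesis
  proof unfold_locales
    show "(\<lambda>x. I +>\<^bsub>M\<^esub> x) ` carrier M = carrier (quot_module M I)"
      by (auto simp: quot_module_def A_RCOSETS_def')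
    show "I +>\<^bsub>M\<^esub> \<zero>\<^bsub>M\<^esub> = \<zero>\<^bsub>quot_module M I\<^esub>"
      using I.a_rcos_const [OF I.zero_closed] by (simp add: quot_module_def)
    show "I +>\<^bsub>M\<^esub> (x \<oplus>\<^bsub>M\<^esub> y) = (I +>\<^bsub>M\<^esub> x) \<oplus>\<^bsub>quot_module M I\<^esub> (I +>\<^bsub>M\<^esub> y)"
      if "x \<in> carrier M" "y \<in> carrier M" for x y
      using I.a_rcos_sum [OF that] by (simp add: quot_module_def)
    show "I +>\<^bsub>M\<^esub> (r \<odot>\<^bsub>M\<^esub> x) = r \<odot>\<^bsub>quot_module M I\<^esub> (I +>\<^bsub>M\<^esub> x)"
      if r: "r \<in> carrier R" and x: "x \<in> carrier M" for r x
    proof -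
      \<comment> \<open>Scalar multiplication on cosets is defined as a union over all
        representatives. Each representative yields the same coset, and the coset is nonempty, so
        the union collapses to it.\<close>
      have "I +>\<^bsub>M\<^esub> (r \<odot>\<^bsub>M\<^esub> y) = I +>\<^bsub>M\<^esub> (r \<odot>\<^bsub>M\<^esub> x)" if y: "y \<in> I +>\<^bsub>M\<^esub> x" for y
      proof -
        obtain i where i: "i \<in> I" "y = i \<oplus>\<^bsub>M\<^esub> x" using y by (auto simp: a_r_coset_def')
        then have "r \<odot>\<^bsub>M\<^esub> y = r \<odot>\<^bsub>M\<^esub> i \<oplus>\<^bsub>M\<^esub> r \<odot>\<^bsub>M\<^esub> x" "r \<odot>\<^bsub>M\<^esub> i \<in> I"
          using r x submoduleE(1,4) [OF I] by (auto intro: smult_r_distr)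
        then have "r \<odot>\<^bsub>M\<^esub> y \<in> I +>\<^bsub>M\<^esub> (r \<odot>\<^bsub>M\<^esub> x)" by (auto simp: a_r_coset_def')
        then show ?thesis
          using I.a_repr_independence' [of "r \<odot>\<^bsub>M\<^esub> y" "r \<odot>\<^bsub>M\<^esub> x"] r x by simp
      qed
      then have "(\<Union>y\<in>I +>\<^bsub>M\<^esub> x. I +>\<^bsub>M\<^esub> (r \<odot>\<^bsub>M\<^esub> y)) =
          (\<Union>y\<in>I +>\<^bsub>M\<^esub> x. I +>\<^bsub>M\<^esub> (r \<odot>\<^bsub>M\<^esub> x))"
        by (rule SUP_cong [OF refl])
      also have "\<dots> = I +>\<^bsub>M\<^esub> (r \<odot>\<^bsub>M\<^esub> x)"
        using I.a_rcos_self [OF x] by (intro cSUP_const) auto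
      finally show ?thesis by (simp add: quot_module_def)
    qed
  qed
qed

lemma (in module) quot_module_kernel:
  assumes I: "submodule I R M"
  shows "{x \<in> carrier M. I +>\<^bsub>M\<^esub> x = \<zero>\<^bsub>quot_module M I\<^esub>} = I"
proof -
  interpret I: abelian_subgroup I M by (rule submodule_abelian_subgroup [OF I])
  show ?thesis
    using I.a_rcos_self I.a_rcos_const submoduleE(1) [OF I] by (auto simp: quot_module_def)
qed

lemma (in module) fin_gen_quot_iff:
  assumes I: "submodule I R M"
  shows "fin_gen_module R (quot_module M I) \<longleftrightarrow> fin_gen_over R M I"
  using module_epi.fin_gen_iff [OF quot_module_epi [OF I]] quot_module_kernel [OF I] by simp

text \<open>For a functional \<open>f\<close> on an algebra with unit this is the kernel of the map
  from \<open>a\<close> to \<open>dual_act A a f\<close>, and also the largest left ideal contained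
  in the kernel of \<open>f\<close>.\<close>

definition annihilator :: "('r, 'x) ring_scheme \<Rightarrow> ('a, 'y) ring_scheme \<Rightarrow> ('a \<Rightarrow> 'r) \<Rightarrow> 'a set" where
  "annihilator R A f = {x \<in> carrier A. \<forall>b\<in>carrier A. f (b \<otimes>\<^bsub>A\<^esub> x) = \<zero>\<^bsub>R\<^esub>}"

section \<open>Left ideals, orbits and annihilators in an algebra\<close>

context assoc_algebra
begin

text \<open>Scalars act through the unit: multiplying \<open>x\<close> by \<open>r\<close> is left
  multiplication by the \<open>r\<close>-multiple of \<open>\<one>\<close>.\<close>

lemma left_ideal_submodule:
  assumes "left_ideal I A"
  shows "submodule I R A"
proof -
  interpret I: additive_subgroup I A using assms by (simp add: left_ideal_def)
  show ?thesis
  proof (rule submoduleI)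
    show "r \<odot>\<^bsub>A\<^esub> x \<in> I" if r: "r \<in> carrier R" and x: "x \<in> I" for r x
    proof -
      have xc: "x \<in> carrier A" using I.a_subset x by blast
      then have "r \<odot>\<^bsub>A\<^esub> x = (r \<odot>\<^bsub>A\<^esub> \<one>\<^bsub>A\<^esub>) \<otimes>\<^bsub>A\<^esub> x"
        using smult_mult_left [of r "\<one>\<^bsub>A\<^esub>" x] r by simp
      then show ?thesis using assms r x by (simp add: left_ideal_def)
    qed
  qed (use I.a_subset I.zero_closed I.a_closed I.a_inv_closed in auto)
qed

lemma submodule_left_ideal:
  assumes "submodule I R A" and "\<And>a x. a \<in> carrier A \<Longrightarrow> x \<in> I \<Longrightarrow> a \<otimes>\<^bsub>A\<^esub> x \<in> I"
  shows "left_ideal I A"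
  using assms by (auto simp: left_ideal_def submodule_def additive_subgroup_def)

context
  fixes f assumes f: "f \<in> mod_hom R A (self_module R)"
begin

lemma functional_closed: "x \<in> carrier A \<Longrightarrow> f x \<in> carrier R"
  using mod_hom_closed [OF f] by simp

lemma functional_add: "x \<in> carrier A \<Longrightarrow> y \<in> carrier A \<Longrightarrow> f (x \<oplus>\<^bsub>A\<^esub> y) = f x \<oplus> f y"
  using mod_hom_add [OF f] by simp

lemma functional_smult: "r \<in> carrier R \<Longrightarrow> x \<in> carrier A \<Longrightarrow> f (r \<odot>\<^bsub>A\<^esub> x) = r \<otimes> f x"
  using mod_hom_smult [OF f] by simp

lemma functional_zero: "f \<zero>\<^bsub>A\<^esub> = \<zero>"
  using mod_hom_zero [OF module_axioms R.module_self_module f] by simp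

lemmas functional_simps = functional_closed functional_add functional_smult functional_zero

text \<open>The orbit is the dual with its carrier replaced. Exhibiting it as the image of
  \<open>A\<close> yields its module structure and, through \<open>fin_gen_iff\<close>, reduces its
  finite generation to the kernel.\<close>

lemma orbit_epi:
  "module_epi R A ((dual_module R A)\<lparr>carrier := (\<lambda>a. dual_act A a f) ` carrier A\<rparr>)
     (\<lambda>a. dual_act A a f)"
proof unfold_locales
qed (simp_all add: dual_module_def dual_act_def functional_simps r_distr smult_mult_right
    cong: restrict_cong)

lemma orbit_kernel:
  "{x \<in> carrier A.
     dual_act A x f = \<zero>\<^bsub>(dual_module R A)\<lparr>carrier := (\<lambda>a. dual_act A a f) ` carrier A\<rparr>\<^esub>} =
   annihilator R A f"
  by (auto simp: dual_module_def dual_act_def fun_eq_iff annihilator_def)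

lemma annihilator_submodule: "submodule (annihilator R A f) R A"
proof (rule submoduleI)
  show "\<ominus>\<^bsub>A\<^esub> x \<in> annihilator R A f" if "x \<in> annihilator R A f" for x
  proof -
    have "f (b \<otimes>\<^bsub>A\<^esub> \<ominus>\<^bsub>A\<^esub> x) = \<zero>" if "b \<in> carrier A" for b
    proof -
      have x: "x \<in> carrier A" "f (b \<otimes>\<^bsub>A\<^esub> x) = \<zero>"
        using \<open>x \<in> annihilator R A f\<close> that by (auto simp: annihilator_def)
      then have "f (b \<otimes>\<^bsub>A\<^esub> x \<oplus>\<^bsub>A\<^esub> b \<otimes>\<^bsub>A\<^esub> \<ominus>\<^bsub>A\<^esub> x) = f (b \<otimes>\<^bsub>A\<^esub> \<ominus>\<^bsub>A\<^esub> x)"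
        using that functional_closed by (subst functional_add) auto
      then show ?thesis
        using x that by (simp add: functional_zero M.r_neg flip: r_distr)
    qed
    then show ?thesis using that by (auto simp: annihilator_def)
  qed
qed (auto simp: annihilator_def functional_simps r_distr smult_mult_right)

lemma annihilator_left_ideal: "left_ideal (annihilator R A f) A"
  by (rule submodule_left_ideal [OF annihilator_submodule])
    (auto simp: annihilator_def simp flip: m_assoc)

text \<open>The orbit of \<open>f\<close> is \<open>A\<close> modulo the annihilator of
  \<open>f\<close>, so membership in the finite dual becomes a condition on a submodule of
  \<open>A\<close>.\<close>

lemma finite_dual_iff: "f \<in> carrier (finite_dual R A) \<longleftrightarrow> fin_gen_over R A (annihilator R A f)"
  using module_epi.fin_gen_iff [OF orbit_epi] orbit_kernel f
  by (simp add: finite_dual_def dual_module_def)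

end

end

section \<open>Dual bases\<close>

text \<open>For infinite \<open>S\<close> both products have the default value \<open>one\<close>,
  which \<open>h\<close> preserves; this is the first case of
  \<open>infinite_finite_induct\<close>.\<close>

lemma hom_finprod:
  assumes G: "comm_group G" and H: "comm_group H" and h: "h \<in> hom G H"
    and f: "f \<in> S \<rightarrow> carrier G"
  shows "h (finprod G f S) = finprod H (\<lambda>s. h (f s)) S"
proof -
  interpret G: comm_group G by fact
  interpret H: comm_group H by fact
  interpret h: group_hom G H h by unfold_locales (rule h)
  have hc: "(\<lambda>s. h (f s)) \<in> S' \<rightarrow> carrier H" if "f \<in> S' \<rightarrow> carrier G" for S'
    using that by (simp add: Pi_def)
  show ?thesis using f
  proof (induction S rule: infinite_finite_induct)
    case (insert s S)
    then show ?case using hc [of S] by (auto simp: Pi_def)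
  qed simp_all
qed

lemma mod_hom_finsum:
  assumes "module R M" "module R N" "h \<in> mod_hom R M N" "f \<in> S \<rightarrow> carrier M"
  shows "h (\<Oplus>\<^bsub>M\<^esub>s\<in>S. f s) = (\<Oplus>\<^bsub>N\<^esub>s\<in>S. h (f s))"
proof -
  interpret M: module R M by fact
  interpret N: module R N by fact
  have "h \<in> hom (add_monoid M) (add_monoid N)"
    using mod_hom_closed [OF assms(3)] mod_hom_add [OF assms(3)] by (auto simp: hom_def)
  then show ?thesis
    using assms(4) by (simp add: finsum_def hom_finprod M.a_comm_group N.a_comm_group)
qed

text \<open>For finite \<open>S\<close> this is the free module on \<open>S\<close>. Its elements
  have type \<open>'p \<Rightarrow> 'r\<close> because \<open>projective_module\<close> provides
  liftings only along surjections from modules over that type.\<close>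

definition coeff_module :: "('r, 'x) ring_scheme \<Rightarrow> 'p set \<Rightarrow> ('r, 'p \<Rightarrow> 'r) module" where
  "coeff_module R S =
     \<lparr>carrier = S \<rightarrow>\<^sub>E carrier R, monoid.mult = undefined, one = undefined,
      ring.zero = (\<lambda>s\<in>S. \<zero>\<^bsub>R\<^esub>), ring.add = (\<lambda>u v. \<lambda>s\<in>S. u s \<oplus>\<^bsub>R\<^esub> v s),
      module.smult = (\<lambda>r u. \<lambda>s\<in>S. r \<otimes>\<^bsub>R\<^esub> u s)\<rparr>"

lemma coeff_module_simps [simp]:
  "carrier (coeff_module R S) = S \<rightarrow>\<^sub>E carrier R"
  "\<zero>\<^bsub>coeff_module R S\<^esub> = (\<lambda>s\<in>S. \<zero>\<^bsub>R\<^esub>)"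
  "u \<oplus>\<^bsub>coeff_module R S\<^esub> v = (\<lambda>s\<in>S. u s \<oplus>\<^bsub>R\<^esub> v s)"
  "r \<odot>\<^bsub>coeff_module R S\<^esub> u = (\<lambda>s\<in>S. r \<otimes>\<^bsub>R\<^esub> u s)"
  by (simp_all add: coeff_module_def)

lemma (in cring) module_coeff_module: "module R (coeff_module R S)"
proof (rule moduleI)
  show "abelian_group (coeff_module R S)"
  proof (rule abelian_groupI)
    fix u assume u: "u \<in> carrier (coeff_module R S)"
    then have uc: "u s \<in> carrier R" if "s \<in> S" for s using that by auto
    then have "(\<lambda>s\<in>S. \<ominus> u s) \<in> carrier (coeff_module R S)"
        "(\<lambda>s\<in>S. \<ominus> u s) \<oplus>\<^bsub>coeff_module R S\<^esub> u = \<zero>\<^bsub>coeff_module R S\<^esub>"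
      by (auto simp: l_neg fun_eq_iff)
    then show "\<exists>v\<in>carrier (coeff_module R S). v \<oplus>\<^bsub>coeff_module R S\<^esub> u = \<zero>\<^bsub>coeff_module R S\<^esub>"
      by blast
    show "\<zero>\<^bsub>coeff_module R S\<^esub> \<oplus>\<^bsub>coeff_module R S\<^esub> u = u"
      using u uc by (auto simp: fun_eq_iff PiE_iff extensional_def)
  qed (auto simp: PiE_iff fun_eq_iff a_ac)
  show "\<one> \<odot>\<^bsub>coeff_module R S\<^esub> u = u" if "u \<in> carrier (coeff_module R S)" for u
    using that by (auto simp: fun_eq_iff PiE_iff extensional_def)
qed (auto simp: is_cring PiE_iff fun_eq_iff l_distr r_distr m_assoc)

text \<open>The free module on a finite generating set \<open>S\<close> maps onto \<open>P\<close>.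
  Projectivity lifts the identity of \<open>P\<close> to a section \<open>k\<close>, whose
  coordinates are the dual functionals.\<close>

lemma projective_dual_basis:
  fixes R :: "('r, 'x) ring_scheme" and P :: "('r, 'p) module"
  assumes proj: "projective_module R P" and fg: "fin_gen_module R P"
  obtains S k where "finite S" "S \<subseteq> carrier P"
    and "\<And>s. s \<in> S \<Longrightarrow> (\<lambda>x\<in>carrier P. k x s) \<in> mod_hom R P (self_module R)"
    and "\<And>x. x \<in> carrier P \<Longrightarrow> x = (\<Oplus>\<^bsub>P\<^esub>s\<in>S. k x s \<odot>\<^bsub>P\<^esub> s)"
proof -
  interpret P: module R P using proj by (simp add: projective_module_def)
  obtain S where S: "finite S" "S \<subseteq> carrier P"
      and gen: "\<And>H. submodule H R P \<Longrightarrow> S \<subseteq> H \<Longrightarrow> H = carrier P"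
    using fg unfolding fin_gen_module_def by blast
  have Sc: "s \<in> carrier P" if "s \<in> S" for s using S that by blast
  let ?N = "coeff_module R S"
  define g where "g = (\<lambda>u\<in>carrier ?N. \<Oplus>\<^bsub>P\<^esub>s\<in>S. u s \<odot>\<^bsub>P\<^esub> s)"
  interpret N: module R ?N by (rule P.R.module_coeff_module)
  have g_eq: "g u = (\<Oplus>\<^bsub>P\<^esub>s\<in>S. u s \<odot>\<^bsub>P\<^esub> s)" if "u \<in> carrier ?N" for u
    using that by (simp add: g_def)
  have summand: "(\<lambda>s. u s \<odot>\<^bsub>P\<^esub> s) \<in> S \<rightarrow> carrier P" if "u \<in> carrier ?N" for u
    using that Sc by auto
  have g_hom: "g \<in> mod_hom R ?N P"
    unfolding g_def
  proof (rule mod_hom_restrictI [OF _ _ _ N.module_axioms])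
    show "(\<Oplus>\<^bsub>P\<^esub>s\<in>S. u s \<odot>\<^bsub>P\<^esub> s) \<in> carrier P" if "u \<in> carrier ?N" for u
      by (rule P.M.finsum_closed [OF summand [OF that]])
    show "(\<Oplus>\<^bsub>P\<^esub>s\<in>S. (u \<oplus>\<^bsub>?N\<^esub> v) s \<odot>\<^bsub>P\<^esub> s) =
        (\<Oplus>\<^bsub>P\<^esub>s\<in>S. u s \<odot>\<^bsub>P\<^esub> s) \<oplus>\<^bsub>P\<^esub> (\<Oplus>\<^bsub>P\<^esub>s\<in>S. v s \<odot>\<^bsub>P\<^esub> s)"
      if u: "u \<in> carrier ?N" and v: "v \<in> carrier ?N" for u v
    proof -
      have "(\<Oplus>\<^bsub>P\<^esub>s\<in>S. (u \<oplus>\<^bsub>?N\<^esub> v) s \<odot>\<^bsub>P\<^esub> s) = (\<Oplus>\<^bsub>P\<^esub>s\<in>S. u s \<odot>\<^bsub>P\<^esub> s \<oplus>\<^bsub>P\<^esub> v s \<odot>\<^bsub>P\<^esub> s)"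
        by (rule P.M.finsum_cong') (use u v Sc in \<open>auto simp: P.smult_l_distr PiE_iff\<close>)
      also have "\<dots> = (\<Oplus>\<^bsub>P\<^esub>s\<in>S. u s \<odot>\<^bsub>P\<^esub> s) \<oplus>\<^bsub>P\<^esub> (\<Oplus>\<^bsub>P\<^esub>s\<in>S. v s \<odot>\<^bsub>P\<^esub> s)"
        by (rule P.M.finsum_addf [OF summand [OF u] summand [OF v]])
      finally show ?thesis .
    qed
    show "(\<Oplus>\<^bsub>P\<^esub>s\<in>S. (r \<odot>\<^bsub>?N\<^esub> u) s \<odot>\<^bsub>P\<^esub> s) = r \<odot>\<^bsub>P\<^esub> (\<Oplus>\<^bsub>P\<^esub>s\<in>S. u s \<odot>\<^bsub>P\<^esub> s)"
      if r: "r \<in> carrier R" and u: "u \<in> carrier ?N" for r u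
    proof -
      have "(\<Oplus>\<^bsub>P\<^esub>s\<in>S. (r \<odot>\<^bsub>?N\<^esub> u) s \<odot>\<^bsub>P\<^esub> s) = (\<Oplus>\<^bsub>P\<^esub>s\<in>S. r \<odot>\<^bsub>P\<^esub> (u s \<odot>\<^bsub>P\<^esub> s))"
        by (rule P.M.finsum_cong') (use r u Sc in \<open>auto simp: P.smult_assoc1 PiE_iff\<close>)
      then show ?thesis using P.finsum_smult_ldistr [OF S(1) r summand [OF u]] by simp
    qed
  qed
  let ?G = "g ` carrier ?N"
  \<comment> \<open>Surjectivity of \<open>g\<close>: its image is a module as the codomain of an
    epimorphism, hence a submodule of \<open>P\<close>, and it contains the generators
    \<open>S\<close>.\<close>
  have "module_epi R ?N (P\<lparr>carrier := ?G\<rparr>) g"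
    by unfold_locales
      (use mod_hom_add [OF g_hom] mod_hom_smult [OF g_hom]
          mod_hom_zero [OF N.module_axioms P.module_axioms g_hom] in simp_all)
  then have "module R (P\<lparr>carrier := ?G\<rparr>)" by (rule module_epi.codomain_module)
  then have "submodule ?G R P"
    using mod_hom_closed [OF g_hom] by (intro P.module_incl_imp_submodule) auto
  moreover have "S \<subseteq> ?G"
  proof
    fix t assume t: "t \<in> S"
    \<comment> \<open>The unit vector at \<open>t\<close> is mapped to \<open>t\<close>.\<close>
    let ?u = "\<lambda>s\<in>S. if t = s then \<one>\<^bsub>R\<^esub> else \<zero>\<^bsub>R\<^esub>"
    have u: "?u \<in> carrier ?N" by auto
    have "g ?u = (\<Oplus>\<^bsub>P\<^esub>s\<in>S. ?u s \<odot>\<^bsub>P\<^esub> s)" by (rule g_eq [OF u])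
    also have "\<dots> = (\<Oplus>\<^bsub>P\<^esub>s\<in>S. if t = s then s else \<zero>\<^bsub>P\<^esub>)"
      by (rule P.M.finsum_cong') (use Sc in auto)
    also have "\<dots> = t"
      by (rule P.M.finsum_singleton) (use t S Sc in auto)
    finally show "t \<in> ?G" using u by (metis imageI)
  qed
  ultimately have surj: "?G = carrier P" by (rule gen)
  \<comment> \<open>The identity, restricted because homomorphisms are extensional; its lift along
    \<open>g\<close> is the section.\<close>
  have "(\<lambda>x\<in>carrier P. x) \<in> mod_hom R P P"
    by (rule mod_hom_restrictI) (auto simp: P.module_axioms)
  then obtain k where k: "k \<in> mod_hom R P ?N"
      and gk: "\<And>x. x \<in> carrier P \<Longrightarrow> g (k x) = (\<lambda>x\<in>carrier P. x) x"
    using proj N.module_axioms P.module_axioms g_hom surj unfolding projective_module_def by blast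
  show thesis
  proof (rule that [OF S])
    show "x = (\<Oplus>\<^bsub>P\<^esub>s\<in>S. k x s \<odot>\<^bsub>P\<^esub> s)" if "x \<in> carrier P" for x
      using gk [OF that] g_eq [OF mod_hom_closed [OF k that]] that by simp
    show "(\<lambda>x\<in>carrier P. k x s) \<in> mod_hom R P (self_module R)" if "s \<in> S" for s
      by (rule mod_hom_restrictI [OF _ _ _ P.module_axioms])
        (use that mod_hom_closed [OF k] mod_hom_add [OF k] mod_hom_smult [OF k] in auto)
  qed
qed

section \<open>The finite dual as a module, and common dual bases for its finite subsets\<close>

lemma finite_dual_simps [simp]:
  "\<zero>\<^bsub>finite_dual R A\<^esub> = \<zero>\<^bsub>dual_module R A\<^esub>"
  "f \<oplus>\<^bsub>finite_dual R A\<^esub> g = f \<oplus>\<^bsub>dual_module R A\<^esub> g"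
  "r \<odot>\<^bsub>finite_dual R A\<^esub> f = r \<odot>\<^bsub>dual_module R A\<^esub> f"
  by (simp_all add: finite_dual_def)

context assoc_algebra
begin

lemma module_dual: "module R (dual_module R A)"
  unfolding dual_module_def by (intro module_hom_module module_axioms R.module_self_module)

lemma finite_dual_subset: "carrier (finite_dual R A) \<subseteq> mod_hom R A (self_module R)"
  by (auto simp: finite_dual_def dual_module_def)

text \<open>Enlarging \<open>I\<close> to the annihilator keeps the quotient finitely generated, so
  any such \<open>I\<close> certifies membership.\<close>

lemma finite_dualI:
  assumes f: "f \<in> mod_hom R A (self_module R)"
    and "fin_gen_over R A I" "I \<subseteq> annihilator R A f"
  shows "f \<in> carrier (finite_dual R A)"
  using finite_dual_iff [OF f] fin_gen_over_mono [OF assms(2,3)]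
  by (auto simp: annihilator_def)

lemma finite_dual_annihilator:
  assumes "f \<in> carrier (finite_dual R A)"
  shows "submodule (annihilator R A f) R A" "fin_gen_over R A (annihilator R A f)"
  using assms finite_dual_subset annihilator_submodule finite_dual_iff by auto

text \<open>Annihilators only grow under scalar multiplication, and that of a sum contains the
  intersection of the two annihilators. Noetherianity is what makes \<open>A\<close> finitely
  generated modulo this intersection.\<close>

lemma finite_dual_submodule:
  assumes noeth: "noetherian_ring R"
  shows "submodule (carrier (finite_dual R A)) R (dual_module R A)"
proof -
  interpret D: module R "dual_module R A" by (rule module_dual)
  let ?C = "carrier (finite_dual R A)"
  have sub: "?C \<subseteq> carrier (dual_module R A)" using finite_dual_subset by (simp add: dual_module_def)
  have smult: "r \<odot>\<^bsub>dual_module R A\<^esub> f \<in> ?C" if r: "r \<in> carrier R" and f: "f \<in> ?C" for r f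
  proof (rule finite_dualI [OF _ finite_dual_annihilator(2) [OF f]])
    show "r \<odot>\<^bsub>dual_module R A\<^esub> f \<in> mod_hom R A (self_module R)"
      using D.smult_closed [OF r, of f] f sub by (auto simp: dual_module_def)
    show "annihilator R A f \<subseteq> annihilator R A (r \<odot>\<^bsub>dual_module R A\<^esub> f)"
      using r by (auto simp: annihilator_def dual_module_def)
  qed
  show ?thesis
  proof (rule D.submoduleI [OF sub _ _ _ smult])
    show "\<zero>\<^bsub>dual_module R A\<^esub> \<in> ?C"
    proof (rule finite_dualI [where I = "carrier A"])
      show "\<zero>\<^bsub>dual_module R A\<^esub> \<in> mod_hom R A (self_module R)"
        using D.M.zero_closed by (simp add: dual_module_def)
      show "fin_gen_over R A (carrier A)"
        \<comment> \<open>The empty family gives \<open>carrier A\<close> itself.\<close>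
        using fin_gen_over_Inter [OF noeth, of "{}"] by simp
    qed (auto simp: annihilator_def dual_module_def)
    show "\<ominus>\<^bsub>dual_module R A\<^esub> f \<in> ?C" if "f \<in> ?C" for f
      using smult [OF _ that, of "\<ominus> \<one>"] D.smult_l_minus [of \<one> f] that sub by auto
    show "f \<oplus>\<^bsub>dual_module R A\<^esub> g \<in> ?C" if f: "f \<in> ?C" and g: "g \<in> ?C" for f g
    proof (rule finite_dualI)
      show "f \<oplus>\<^bsub>dual_module R A\<^esub> g \<in> mod_hom R A (self_module R)"
        using D.M.a_closed [of f g] f g sub by (auto simp: dual_module_def)
      show "fin_gen_over R A (annihilator R A f \<inter> annihilator R A g)"
        using f g by (intro fin_gen_over_Int [OF noeth] finite_dual_annihilator)
    qed (auto simp: annihilator_def dual_module_def)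
  qed
qed

lemma module_finite_dual:
  assumes "noetherian_ring R"
  shows "module R (finite_dual R A)"
proof -
  have "finite_dual R A = (dual_module R A)\<lparr>carrier := carrier (finite_dual R A)\<rparr>"
    by (simp add: finite_dual_def)
  then show ?thesis
    using submodule.submodule_is_module [OF finite_dual_submodule [OF assms] module_dual] by simp
qed

lemma bilinear_pairing_eval:
  assumes "noetherian_ring R"
  shows "bilinear_pairing R (finite_dual R A) A (\<lambda>f a. f a)"
proof -
  \<comment> \<open>Functionals are extensional, so currying the evaluation pairing returns
    \<open>f\<close> itself.\<close>
  have ext: "(\<lambda>a\<in>carrier A. f a) = f" if "f \<in> carrier (finite_dual R A)" for f
    using that finite_dual_subset mod_hom_extensional by (blast intro: extensional_restrict)
  have "(\<lambda>f\<in>carrier (finite_dual R A). f a) \<in> mod_hom R (finite_dual R A) (self_module R)"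
    if "a \<in> carrier A" for a
    by (rule mod_hom_restrictI [OF _ _ _ module_finite_dual [OF assms]])
      (use that finite_dual_subset functional_closed in \<open>auto simp: dual_module_def\<close>)
  then show ?thesis
    using ext finite_dual_subset by (auto simp: bilinear_pairing_def)
qed

text \<open>Indices are cosets of \<open>J\<close>, which explains the type of \<open>S\<close>;
  \<open>p\<close> chooses representatives and \<open>c\<close> pulls the dual functionals back to
  \<open>A\<close>. As \<open>J\<close> lies in all annihilators of members of \<open>F\<close> at
  once, one system serves the whole of \<open>F\<close>.\<close>

lemma finite_dual_common_basis:
  assumes noeth: "noetherian_ring R" and Pl: "property_Pl R A"
    and F: "finite F" "F \<subseteq> carrier (finite_dual R A)"
  obtains S :: "'c set set" and p c where "finite S" "\<And>s. s \<in> S \<Longrightarrow> p s \<in> carrier A"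
    and "\<And>s. s \<in> S \<Longrightarrow> c s \<in> carrier (finite_dual R A)"
    and "\<And>f. f \<in> F \<Longrightarrow> f = (\<Oplus>\<^bsub>finite_dual R A\<^esub>s\<in>S. f (p s) \<odot>\<^bsub>finite_dual R A\<^esub> c s)"
proof -
  let ?T = "finite_dual R A"
  interpret T: module R ?T by (rule module_finite_dual [OF noeth])
  let ?I = "carrier A \<inter> (\<Inter>f\<in>F. annihilator R A f)"
  have I: "submodule ?I R A" "fin_gen_over R A ?I"
    using fin_gen_over_Inter [OF noeth F(1), of "annihilator R A"] finite_dual_annihilator F(2)
    by auto
  have "left_ideal ?I A"
  proof (rule submodule_left_ideal [OF I(1)])
    fix a x assume a: "a \<in> carrier A" and x: "x \<in> ?I"
    have "left_ideal (annihilator R A f) A" if "f \<in> F" for f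
      using that F(2) finite_dual_subset annihilator_left_ideal by blast
    then show "a \<otimes>\<^bsub>A\<^esub> x \<in> ?I" using a x by (auto simp: left_ideal_def)
  qed
  moreover have "fin_gen_module R (quot_module A ?I)"
    using I fin_gen_quot_iff by blast
  ultimately obtain J where J: "left_ideal J A" "J \<subseteq> ?I"
      "fin_gen_module R (quot_module A J)" "projective_module R (quot_module A J)"
    using Pl unfolding property_Pl_def by blast
  let ?P = "quot_module A J"
  have Js: "submodule J R A" by (rule left_ideal_submodule [OF J(1)])
  have Jfg: "fin_gen_over R A J" using J(3) fin_gen_quot_iff [OF Js] by blast
  interpret q: module_epi R A ?P "\<lambda>x. J +>\<^bsub>A\<^esub> x" by (rule quot_module_epi [OF Js])
  obtain S k where S: "finite S" "S \<subseteq> carrier ?P"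
      and k: "\<And>s. s \<in> S \<Longrightarrow> (\<lambda>x\<in>carrier ?P. k x s) \<in> mod_hom R ?P (self_module R)"
      and basis: "\<And>x. x \<in> carrier ?P \<Longrightarrow> x = (\<Oplus>\<^bsub>?P\<^esub>s\<in>S. k x s \<odot>\<^bsub>?P\<^esub> s)"
    using projective_dual_basis [OF J(4,3)] by blast
  have "\<forall>s\<in>S. \<exists>a. a \<in> carrier A \<and> J +>\<^bsub>A\<^esub> a = s"
    using S(2) unfolding q.image [symmetric] by auto
  then obtain p where p: "\<And>s. s \<in> S \<Longrightarrow> p s \<in> carrier A" "\<And>s. s \<in> S \<Longrightarrow> J +>\<^bsub>A\<^esub> p s = s"
    by metis
  define c where "c = (\<lambda>s. \<lambda>a\<in>carrier A. k (J +>\<^bsub>A\<^esub> a) s)"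
  have c_hom: "c s \<in> mod_hom R A (self_module R)" if "s \<in> S" for s
    unfolding c_def
    by (rule mod_hom_restrictI [OF _ _ _ module_axioms])
      (use mod_hom_closed [OF k [OF that]] mod_hom_add [OF k [OF that]]
          mod_hom_smult [OF k [OF that]] q.hom_closed q.N.M.a_closed q.N.smult_closed in
        \<open>simp_all add: q.hom_add q.hom_smult\<close>)
  have c_closed: "c s a \<in> carrier R" if "s \<in> S" "a \<in> carrier A" for s a
    by (rule functional_closed [OF c_hom [OF that(1)] that(2)])
  have c_J: "J \<subseteq> annihilator R A (c s)" if s: "s \<in> S" for s
  proof
    fix x assume x: "x \<in> J"
    have "c s (b \<otimes>\<^bsub>A\<^esub> x) = \<zero>" if "b \<in> carrier A" for b
    proof -
      have "b \<otimes>\<^bsub>A\<^esub> x \<in> J" using J(1) that x by (simp add: left_ideal_def)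
      then have "b \<otimes>\<^bsub>A\<^esub> x \<in> carrier A" "J +>\<^bsub>A\<^esub> (b \<otimes>\<^bsub>A\<^esub> x) = \<zero>\<^bsub>?P\<^esub>"
        using quot_module_kernel [OF Js] by blast+
      then show ?thesis
        using mod_hom_zero [OF q.N.module_axioms R.module_self_module k [OF s]]
        by (simp add: c_def)
    qed
    then show "x \<in> annihilator R A (c s)"
      using x submoduleE(1) [OF Js] by (auto simp: annihilator_def)
  qed
  have c: "c s \<in> carrier ?T" if "s \<in> S" for s
    by (rule finite_dualI [OF c_hom [OF that] Jfg c_J [OF that]])
  \<comment> \<open>By the dual basis, \<open>a\<close> and \<open>?b\<close>, the combination of
    the \<open>p s\<close> with coefficients \<open>c s a\<close>, have the same coset modulo
    \<open>J\<close>. Since \<open>f\<close> vanishes on \<open>J\<close>, it takes the same value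
    on both.\<close>
  have expand: "f a = (\<Oplus>s\<in>S. f (p s) \<otimes> c s a)" if f: "f \<in> F" and a: "a \<in> carrier A" for f a
  proof -
    have fh: "f \<in> mod_hom R A (self_module R)" using f F(2) finite_dual_subset by blast
    note f_simps = functional_closed [OF fh] functional_add [OF fh] functional_smult [OF fh]
    let ?b = "\<Oplus>\<^bsub>A\<^esub>s\<in>S. c s a \<odot>\<^bsub>A\<^esub> p s"
    have terms: "(\<lambda>s. c s a \<odot>\<^bsub>A\<^esub> p s) \<in> S \<rightarrow> carrier A" using p(1) c_closed a by auto
    have b: "?b \<in> carrier A" by (rule M.finsum_closed [OF terms])
    have q_hom: "(\<lambda>x\<in>carrier A. J +>\<^bsub>A\<^esub> x) \<in> mod_hom R A ?P"
      by (rule mod_hom_restrictI [OF _ _ _ module_axioms])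
        (simp_all add: q.hom_closed q.hom_add q.hom_smult)
    have "J +>\<^bsub>A\<^esub> ?b = (\<Oplus>\<^bsub>?P\<^esub>s\<in>S. (\<lambda>x\<in>carrier A. J +>\<^bsub>A\<^esub> x) (c s a \<odot>\<^bsub>A\<^esub> p s))"
      using mod_hom_finsum [OF module_axioms q.N.module_axioms q_hom terms] b by simp
    also have "\<dots> = (\<Oplus>\<^bsub>?P\<^esub>s\<in>S. k (J +>\<^bsub>A\<^esub> a) s \<odot>\<^bsub>?P\<^esub> s)"
    proof (rule q.N.M.finsum_cong')
      fix s assume s: "s \<in> S"
      have "J +>\<^bsub>A\<^esub> (c s a \<odot>\<^bsub>A\<^esub> p s) = c s a \<odot>\<^bsub>?P\<^esub> s"
        using q.hom_smult [OF c_closed [OF s a] p(1) [OF s]] p(2) [OF s] by simp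
      then show "(\<lambda>x\<in>carrier A. J +>\<^bsub>A\<^esub> x) (c s a \<odot>\<^bsub>A\<^esub> p s) = k (J +>\<^bsub>A\<^esub> a) s \<odot>\<^bsub>?P\<^esub> s"
        using a c_closed [OF s a] p(1) [OF s] by (simp add: c_def)
    next
      show "(\<lambda>s. k (J +>\<^bsub>A\<^esub> a) s \<odot>\<^bsub>?P\<^esub> s) \<in> S \<rightarrow> carrier ?P"
        using c_closed [OF _ a] a S(2) by (auto simp: c_def)
    qed simp
    also have "\<dots> = J +>\<^bsub>A\<^esub> a"
      by (rule basis [symmetric]) (rule q.hom_closed [OF a])
    finally have "J +>\<^bsub>A\<^esub> (a \<ominus>\<^bsub>A\<^esub> ?b) = \<zero>\<^bsub>?P\<^esub>"
      using a b q.hom_closed [OF a] by (simp add: a_minus_def q.hom_add q.hom_minus q.N.M.r_neg)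
    then have "a \<ominus>\<^bsub>A\<^esub> ?b \<in> J" using quot_module_kernel [OF Js] a b by auto
    then have "a \<ominus>\<^bsub>A\<^esub> ?b \<in> annihilator R A f" using J(2) f by blast
    \<comment> \<open>The annihilator condition at the unit says that \<open>f\<close> itself
      vanishes on the difference.\<close>
    then have "f (\<one>\<^bsub>A\<^esub> \<otimes>\<^bsub>A\<^esub> (a \<ominus>\<^bsub>A\<^esub> ?b)) = \<zero>"
      unfolding annihilator_def by blast
    then have "f (a \<ominus>\<^bsub>A\<^esub> ?b) = \<zero>" using a b by simp
    then have "f ((a \<ominus>\<^bsub>A\<^esub> ?b) \<oplus>\<^bsub>A\<^esub> ?b) = f ?b"
      using a b f_simps by simp
    then have "f a = f ?b" using a b by (simp add: a_minus_def M.a_assoc M.l_neg)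
    also have "\<dots> = (\<Oplus>\<^bsub>self_module R\<^esub>s\<in>S. f (c s a \<odot>\<^bsub>A\<^esub> p s))"
      by (rule mod_hom_finsum [OF module_axioms R.module_self_module fh terms])
    \<comment> \<open>\<open>self_module R\<close> has the carrier, addition and zero of
      \<open>R\<close>, so the two sums agree once unfolded.\<close>
    also have "\<dots> = (\<Oplus>s\<in>S. f (c s a \<odot>\<^bsub>A\<^esub> p s))"
      by (simp add: finsum_def self_module_def finprod_def)
    also have "\<dots> = (\<Oplus>s\<in>S. f (p s) \<otimes> c s a)"
      by (rule R.finsum_cong') (use f_simps p(1) c_closed a in \<open>auto simp: R.m_comm\<close>)
    finally show ?thesis .
  qed
  have F_basis: "f = (\<Oplus>\<^bsub>?T\<^esub>s\<in>S. f (p s) \<odot>\<^bsub>?T\<^esub> c s)" (is "f = ?g") if f: "f \<in> F" for f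
  proof (rule extensionalityI)
    have fT: "f \<in> carrier ?T" using f F(2) by blast
    then have fh: "f \<in> mod_hom R A (self_module R)" using finite_dual_subset by blast
    have terms: "(\<lambda>s. f (p s) \<odot>\<^bsub>?T\<^esub> c s) \<in> S \<rightarrow> carrier ?T"
      using functional_closed [OF fh] p(1) c T.smult_closed by blast
    have gT: "?g \<in> carrier ?T" by (rule T.M.finsum_closed [OF terms])
    show "f \<in> extensional (carrier A)" by (rule mod_hom_extensional [OF fh])
    show "?g \<in> extensional (carrier A)" using gT finite_dual_subset mod_hom_extensional by blast
    fix a assume a: "a \<in> carrier A"
    \<comment> \<open>Evaluation at \<open>a\<close> is linear on the finite dual and therefore
      commutes with the sum, which reduces the claim to \<open>expand\<close>.\<close>
    have ev: "(\<lambda>f\<in>carrier ?T. f a) \<in> mod_hom R ?T (self_module R)"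
      using bilinear_pairing_eval [OF noeth] a by (simp add: bilinear_pairing_def)
    have "?g a = (\<Oplus>\<^bsub>self_module R\<^esub>s\<in>S. (\<lambda>f\<in>carrier ?T. f a) (f (p s) \<odot>\<^bsub>?T\<^esub> c s))"
      using mod_hom_finsum [OF T.module_axioms R.module_self_module ev terms] gT by simp
    also have "\<dots> = (\<Oplus>s\<in>S. (\<lambda>f\<in>carrier ?T. f a) (f (p s) \<odot>\<^bsub>?T\<^esub> c s))"
      by (simp add: finsum_def self_module_def finprod_def)
    also have "\<dots> = (\<Oplus>s\<in>S. f (p s) \<otimes> c s a)"
    proof (rule R.finsum_cong')
      fix s assume s: "s \<in> S"
      have "f (p s) \<odot>\<^bsub>?T\<^esub> c s \<in> carrier ?T" using terms s by blast
      then show "(\<lambda>f\<in>carrier ?T. f a) (f (p s) \<odot>\<^bsub>?T\<^esub> c s) = f (p s) \<otimes> c s a"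
        using a by (simp add: dual_module_def)
    qed (use functional_closed [OF fh] p(1) c_closed a in auto)
    also have "\<dots> = f a" by (rule expand [OF f a, symmetric])
    finally show "f a = ?g a" by simp
  qed
  show thesis by (rule that [OF S(1) p(1) c F_basis])
qed

end

section \<open>Tensor products\<close>

locale module_tensor = M: module R M + T: module R T
  for R :: "('r, 'x) ring_scheme" and M :: "('r, 'm, 'w) module_scheme"
    and T :: "('r, 't, 'z) module_scheme"
begin

abbreviation "pairs \<equiv> free_Abelian_group (carrier M \<times> carrier T)"
abbreviation "kern \<equiv> tensor_kernel R M T"
abbreviation "tensor \<equiv> tensor_product R M T"

sublocale pairs: comm_group pairs
  by (rule abelian_free_Abelian_group)

lemma kern_normal: "kern \<lhd> pairs"
  by (rule normal_tensor_kernel(1) [OF M.module_axioms T.module_axioms])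

lemma kern_subgroup: "subgroup kern pairs"
  using kern_normal by (rule normal_imp_subgroup)

lemma relation_in_kern: "x \<in> tensor_relations R M T \<Longrightarrow> x \<in> kern"
  unfolding tensor_kernel_def by (rule generate.incl)

sublocale tensor: comm_group tensor
  unfolding tensor_product_def by (rule pairs.abelian_FactGroup [OF kern_subgroup])

lemma proj_hom: "(\<lambda>x. kern #>\<^bsub>pairs\<^esub> x) \<in> hom pairs tensor"
  unfolding tensor_product_def by (rule normal.r_coset_hom_Mod [OF kern_normal])

lemma tensor_carrier: "carrier tensor = (\<lambda>x. kern #>\<^bsub>pairs\<^esub> x) ` carrier pairs"
  by (auto simp: tensor_product_def FactGroup_def RCOSETS_def)

lemma pair_in_pairs: "m \<in> carrier M \<Longrightarrow> t \<in> carrier T \<Longrightarrow> frag_of (m, t) \<in> carrier pairs"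
  by simp

lemma pure_tensor_closed:
  "m \<in> carrier M \<Longrightarrow> t \<in> carrier T \<Longrightarrow> pure_tensor R M T m t \<in> carrier tensor"
  unfolding pure_tensor_def tensor_carrier by (intro imageI pair_in_pairs)

lemma coset_eqI:
  assumes "x \<in> carrier pairs" "y \<in> carrier pairs" "x - y \<in> kern"
  shows "kern #>\<^bsub>pairs\<^esub> x = kern #>\<^bsub>pairs\<^esub> y"
proof -
  have "x = (x - y) \<otimes>\<^bsub>pairs\<^esub> y" by simp
  then have "x \<in> kern #>\<^bsub>pairs\<^esub> y" using assms(3) unfolding r_coset_def by blast
  then show ?thesis using pairs.repr_independence [OF _ assms(2) kern_subgroup] by simp
qed

lemma coset_mult:
  assumes "x \<in> carrier pairs" "y \<in> carrier pairs"
  shows "(kern #>\<^bsub>pairs\<^esub> x) \<otimes>\<^bsub>tensor\<^esub> (kern #>\<^bsub>pairs\<^esub> y) = kern #>\<^bsub>pairs\<^esub> (x + y)"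
  using hom_mult [OF proj_hom assms] by simp

text \<open>The hypothesis on \<open>x - y - z\<close> has the shape of the two biadditivity
  relations.\<close>

lemma coset_addI:
  assumes "x \<in> carrier pairs" "y \<in> carrier pairs" "z \<in> carrier pairs" "x - y - z \<in> kern"
  shows "kern #>\<^bsub>pairs\<^esub> x = (kern #>\<^bsub>pairs\<^esub> y) \<otimes>\<^bsub>tensor\<^esub> (kern #>\<^bsub>pairs\<^esub> z)"
proof -
  have "y + z \<in> carrier pairs" using pairs.m_closed [OF assms(2,3)] by simp
  then show ?thesis
    using coset_eqI [OF assms(1), of "y + z"] assms(4) coset_mult [OF assms(2,3)]
    by (simp add: diff_diff_eq)
qed

lemma pure_tensor_add_left:
  assumes "m \<in> carrier M" "m' \<in> carrier M" "t \<in> carrier T"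
  shows "pure_tensor R M T (m \<oplus>\<^bsub>M\<^esub> m') t =
    pure_tensor R M T m t \<otimes>\<^bsub>tensor\<^esub> pure_tensor R M T m' t"
  unfolding pure_tensor_def
proof (rule coset_addI)
  show "frag_of (m \<oplus>\<^bsub>M\<^esub> m', t) - frag_of (m, t) - frag_of (m', t) \<in> kern"
    by (rule relation_in_kern) (use assms in \<open>auto simp: tensor_relations_def\<close>)
qed (use assms in auto)

lemma pure_tensor_add_right:
  assumes "m \<in> carrier M" "t \<in> carrier T" "t' \<in> carrier T"
  shows "pure_tensor R M T m (t \<oplus>\<^bsub>T\<^esub> t') =
    pure_tensor R M T m t \<otimes>\<^bsub>tensor\<^esub> pure_tensor R M T m t'"
  unfolding pure_tensor_def
proof (rule coset_addI)
  show "frag_of (m, t \<oplus>\<^bsub>T\<^esub> t') - frag_of (m, t) - frag_of (m, t') \<in> kern"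
    by (rule relation_in_kern) (use assms in \<open>auto simp: tensor_relations_def\<close>)
qed (use assms in auto)

lemma pure_tensor_smult:
  assumes "r \<in> carrier R" "m \<in> carrier M" "t \<in> carrier T"
  shows "pure_tensor R M T (r \<odot>\<^bsub>M\<^esub> m) t = pure_tensor R M T m (r \<odot>\<^bsub>T\<^esub> t)"
  unfolding pure_tensor_def
proof (rule coset_eqI)
  show "frag_of (r \<odot>\<^bsub>M\<^esub> m, t) - frag_of (m, r \<odot>\<^bsub>T\<^esub> t) \<in> kern"
    by (rule relation_in_kern) (use assms in \<open>auto simp: tensor_relations_def\<close>)
qed (use assms in auto)

lemma pure_tensor_hom_right:
  "m \<in> carrier M \<Longrightarrow> pure_tensor R M T m \<in> hom (add_monoid T) tensor"
  by (auto simp: hom_def pure_tensor_closed pure_tensor_add_right)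

text \<open>Sending \<open>u\<close> to the sum of the tensors of \<open>u (p s)\<close> with
  \<open>c s\<close> is an additive left inverse of \<alpha> on tensors whose second components lie
  in \<open>F\<close>. On a generator, the scalars \<open>pr t (p s)\<close> move across the tensor
  sign and the sum contracts to \<open>t\<close>.\<close>

lemma alpha_map_recover:
  fixes A :: "('r, 'a, 'y) module_scheme"
  assumes A: "module R A" and pr: "bilinear_pairing R T A pr"
    and S: "\<And>s. s \<in> S \<Longrightarrow> p s \<in> carrier A" "\<And>s. s \<in> S \<Longrightarrow> c s \<in> carrier T"
    and F: "F \<subseteq> carrier T"
      "\<And>t. t \<in> F \<Longrightarrow> t = (\<Oplus>\<^bsub>T\<^esub>s\<in>S. pr t (p s) \<odot>\<^bsub>T\<^esub> c s)"
    and x: "Poly_Mapping.keys x \<subseteq> carrier M \<times> F"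
  shows "kern #>\<^bsub>pairs\<^esub> x =
    (\<Otimes>\<^bsub>tensor\<^esub>s\<in>S. pure_tensor R M T (alpha_map R T A pr M (kern #>\<^bsub>pairs\<^esub> x) (p s)) (c s))"
proof -
  let ?H = "add_monoid (hom_module R A M)"
  let ?\<alpha> = "alpha_map R T A pr M"
  define \<Psi> where "\<Psi> = (\<lambda>u. \<Otimes>\<^bsub>tensor\<^esub>s\<in>S. pure_tensor R M T (u (p s)) (c s))"
  define \<phi> where "\<phi> = (\<lambda>x. \<Psi> (?\<alpha> (kern #>\<^bsub>pairs\<^esub> x)))"
  have al: "is_alpha_map R T A pr M ?\<alpha>"
    unfolding alpha_map_def
    by (rule theI' [OF alpha_map_ex1 [OF T.module_axioms A pr M.module_axioms]])
  have prc: "pr t a \<in> carrier R" if "t \<in> carrier T" "a \<in> carrier A" for t a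
    using pr that mod_hom_closed [of "\<lambda>a\<in>carrier A. pr t a" R A "self_module R" a]
    by (simp add: bilinear_pairing_def)
  have pure: "(\<lambda>s. pure_tensor R M T (u (p s)) (c s)) \<in> S \<rightarrow> carrier tensor"
    if "u \<in> carrier ?H" for u
    using that S mod_hom_closed [of u R A M] by (auto intro!: pure_tensor_closed)
  have \<Psi>: "\<Psi> \<in> hom ?H tensor"
  proof (rule homI)
    fix u assume u: "u \<in> carrier ?H"
    then show "\<Psi> u \<in> carrier tensor"
      unfolding \<Psi>_def by (intro tensor.finprod_closed pure)
    fix v assume v: "v \<in> carrier ?H"
    have "\<Psi> (u \<otimes>\<^bsub>?H\<^esub> v) = (\<Otimes>\<^bsub>tensor\<^esub>s\<in>S. pure_tensor R M T (u (p s)) (c s) \<otimes>\<^bsub>tensor\<^esub>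
        pure_tensor R M T (v (p s)) (c s))"
      unfolding \<Psi>_def
    proof (rule tensor.finprod_cong' [OF refl])
      show "(\<lambda>s. pure_tensor R M T (u (p s)) (c s) \<otimes>\<^bsub>tensor\<^esub> pure_tensor R M T (v (p s)) (c s))
          \<in> S \<rightarrow> carrier tensor"
        using pure [OF u] pure [OF v] by (auto simp: Pi_def)
      show "pure_tensor R M T ((u \<otimes>\<^bsub>?H\<^esub> v) (p s)) (c s) =
          pure_tensor R M T (u (p s)) (c s) \<otimes>\<^bsub>tensor\<^esub> pure_tensor R M T (v (p s)) (c s)"
        if "s \<in> S" for s
        using u v that S mod_hom_closed [of u R A M] mod_hom_closed [of v R A M]
        by (simp add: pure_tensor_add_left)
    qed
    also have "\<dots> = \<Psi> u \<otimes>\<^bsub>tensor\<^esub> \<Psi> v"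
      unfolding \<Psi>_def by (rule tensor.finprod_multf [OF pure [OF u] pure [OF v]])
    finally show "\<Psi> (u \<otimes>\<^bsub>?H\<^esub> v) = \<Psi> u \<otimes>\<^bsub>tensor\<^esub> \<Psi> v" .
  qed
  have al_hom: "?\<alpha> \<in> hom tensor ?H" using al by (simp add: is_alpha_map_def)
  have "\<phi> \<in> hom pairs tensor"
    using Group.hom_compose [OF Group.hom_compose [OF proj_hom al_hom] \<Psi>]
    by (simp add: \<phi>_def o_def)
  then interpret \<phi>: group_hom pairs tensor \<phi>
    by unfold_locales
  interpret proj: group_hom pairs tensor "\<lambda>x. kern #>\<^bsub>pairs\<^esub> x"
    by unfold_locales (rule proj_hom)
  \<comment> \<open>Stated for an arbitrary homomorphism because the induction on the free abelian
    group proceeds by differences and compares \<open>\<phi>\<close> with the projection.\<close>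
  have diff: "g (x - y) = g x \<otimes>\<^bsub>tensor\<^esub> inv\<^bsub>tensor\<^esub> g y"
    if "group_hom pairs tensor g" "x \<in> carrier pairs" "y \<in> carrier pairs" for g x y
  proof -
    interpret g: group_hom pairs tensor g by fact
    have "x - y = x \<otimes>\<^bsub>pairs\<^esub> inv\<^bsub>pairs\<^esub> y" using that by simp
    then show ?thesis using that by (metis g.hom_mult g.hom_inv pairs.inv_closed)
  qed
  have "\<phi> x = kern #>\<^bsub>pairs\<^esub> x"
  \<comment> \<open>The support stays inside \<open>carrier M \<times> F\<close> throughout, since
    the expansion in \<open>c\<close> is available only for members of \<open>F\<close>.\<close>
  proof (rule free_Abelian_group_induct [OF x])
    show "\<phi> 0 = kern #>\<^bsub>pairs\<^esub> 0" using \<phi>.hom_one proj.hom_one by simp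
  next
    fix y z
    assume yz: "Poly_Mapping.keys y \<subseteq> carrier M \<times> F" "Poly_Mapping.keys z \<subseteq> carrier M \<times> F"
      "\<phi> y = kern #>\<^bsub>pairs\<^esub> y" "\<phi> z = kern #>\<^bsub>pairs\<^esub> z"
    have "carrier M \<times> F \<subseteq> carrier M \<times> carrier T" using F(1) by auto
    then have "y \<in> carrier pairs" "z \<in> carrier pairs" using yz(1,2) by auto
    then show "\<phi> (y - z) = kern #>\<^bsub>pairs\<^esub> (y - z)"
      using diff [OF \<phi>.group_hom_axioms] diff [OF proj.group_hom_axioms] yz(3,4) by simp
  next
    fix q assume "q \<in> carrier M \<times> F"
    then obtain m t where q: "q = (m, t)" and m: "m \<in> carrier M" and t: "t \<in> F" by auto
    have tc: "t \<in> carrier T" using t F(1) by blast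
    have terms: "(\<lambda>s. pr t (p s) \<odot>\<^bsub>T\<^esub> c s) \<in> S \<rightarrow> carrier T" using prc [OF tc] S by auto
    have "?\<alpha> (kern #>\<^bsub>pairs\<^esub> frag_of q) = (\<lambda>a\<in>carrier A. pr t a \<odot>\<^bsub>M\<^esub> m)"
      using al m tc unfolding is_alpha_map_def q pure_tensor_def by blast
    then have "\<phi> (frag_of q) =
        (\<Otimes>\<^bsub>tensor\<^esub>s\<in>S. pure_tensor R M T ((\<lambda>a\<in>carrier A. pr t a \<odot>\<^bsub>M\<^esub> m) (p s)) (c s))"
      by (simp add: \<phi>_def \<Psi>_def)
    also have "\<dots> = (\<Otimes>\<^bsub>tensor\<^esub>s\<in>S. pure_tensor R M T m (pr t (p s) \<odot>\<^bsub>T\<^esub> c s))"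
      by (rule tensor.finprod_cong' [OF refl])
        (use m S prc [OF tc] in \<open>auto simp: pure_tensor_smult intro!: pure_tensor_closed\<close>)
    \<comment> \<open>Additivity in the second argument carries the sum in \<open>T\<close> to the
      product in the multiplicatively written tensor group.\<close>
    also have "\<dots> = pure_tensor R M T m (\<Oplus>\<^bsub>T\<^esub>s\<in>S. pr t (p s) \<odot>\<^bsub>T\<^esub> c s)"
      unfolding finsum_def
      by (rule hom_finprod [symmetric])
        (use T.a_comm_group tensor.comm_group_axioms pure_tensor_hom_right [OF m] terms in auto)
    also have "\<dots> = kern #>\<^bsub>pairs\<^esub> frag_of q"
      using F(2) [OF t] by (simp add: pure_tensor_def q)
    finally show "\<phi> (frag_of q) = kern #>\<^bsub>pairs\<^esub> frag_of q" .
  qed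
  then show ?thesis by (simp add: \<phi>_def \<Psi>_def)
qed

text \<open>A representative in the free abelian group involves only finitely many elements of
  \<open>T\<close>, so a dual system for finite subsets suffices. No global left inverse of \<alpha>
  is constructed.\<close>

lemma alpha_map_inj:
  fixes A :: "('r, 'a, 'y) module_scheme"
  assumes A: "module R A" and pr: "bilinear_pairing R T A pr"
    and basis: "\<And>F. finite F \<Longrightarrow> F \<subseteq> carrier T \<Longrightarrow>
      \<exists>(S :: 's set) p c. (\<forall>s\<in>S. p s \<in> carrier A) \<and> (\<forall>s\<in>S. c s \<in> carrier T) \<and>
        (\<forall>t\<in>F. t = (\<Oplus>\<^bsub>T\<^esub>s\<in>S. pr t (p s) \<odot>\<^bsub>T\<^esub> c s))"
  shows "inj_on (alpha_map R T A pr M) (carrier tensor)"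
proof (rule inj_onI)
  fix u v assume "u \<in> carrier tensor" "v \<in> carrier tensor"
    and eq: "alpha_map R T A pr M u = alpha_map R T A pr M v"
  then obtain x y where x: "x \<in> carrier pairs" "u = kern #>\<^bsub>pairs\<^esub> x"
      and y: "y \<in> carrier pairs" "v = kern #>\<^bsub>pairs\<^esub> y"
    unfolding tensor_carrier by blast
  \<comment> \<open>Second components of both representatives are collected, so that one system
    \<open>S\<close>, \<open>p\<close>, \<open>c\<close> recovers \<open>u\<close> and
    \<open>v\<close> by the same formula.\<close>
  let ?F = "snd ` (Poly_Mapping.keys x \<union> Poly_Mapping.keys y)"
  have keys: "Poly_Mapping.keys x \<subseteq> carrier M \<times> carrier T" "Poly_Mapping.keys y \<subseteq> carrier M \<times> carrier T"
    using x(1) y(1) by auto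
  then have F: "finite ?F" "?F \<subseteq> carrier T" by auto
  have keysF: "Poly_Mapping.keys x \<subseteq> carrier M \<times> ?F" "Poly_Mapping.keys y \<subseteq> carrier M \<times> ?F"
    using keys by force+
  from basis [OF F] obtain S :: "'s set" and p c where S: "\<forall>s\<in>S. p s \<in> carrier A"
      "\<forall>s\<in>S. c s \<in> carrier T" "\<forall>t\<in>?F. t = (\<Oplus>\<^bsub>T\<^esub>s\<in>S. pr t (p s) \<odot>\<^bsub>T\<^esub> c s)"
    by (elim exE conjE) (rule that)
  note recover = alpha_map_recover [OF A pr S(1,2) [rule_format] F(2) S(3) [rule_format]]
  show "u = v"
    unfolding x(2) y(2)
    \<comment> \<open>After rewriting, both sides are the same expression in the common image under
      \<alpha>.\<close>
    by (subst (1 2) recover) (use keysF eq x(2) y(2) in simp_all)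
qed

end

theorem proposition4p2:
  fixes R :: "('r, 'x) ring_scheme" and A :: "('r, 'a, 'y) module_scheme"
  assumes "cring R" and "noetherian_ring R"
    and "assoc_algebra R A" and "property_Pl R A"
  shows "rational_system TYPE('m) R (finite_dual R A) A (\<lambda>f a. f a)"
proof -
  interpret assoc_algebra R A by fact
  have T: "module R (finite_dual R A)" by (rule module_finite_dual [OF assms(2)])
  have pr: "bilinear_pairing R (finite_dual R A) A (\<lambda>f a. f a)"
    by (rule bilinear_pairing_eval [OF assms(2)])
  have "inj_on (alpha_map R (finite_dual R A) A (\<lambda>f a. f a) M)
      (carrier (tensor_product R M (finite_dual R A)))"
    if "module R M" for M :: "('r, 'm) module"
  proof -
    interpret module_tensor R M "finite_dual R A"
      by (intro module_tensor.intro that T)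
    show ?thesis
    proof (rule alpha_map_inj [OF module_axioms pr])
      fix F :: "('a \<Rightarrow> 'r) set"
      assume F: "finite F" "F \<subseteq> carrier (finite_dual R A)"
      \<comment> \<open>The free index type of \<open>alpha_map_inj\<close> becomes
        \<open>'a set\<close>, the type of cosets in \<open>A\<close>.\<close>
      obtain S :: "'a set set" and p c where S: "finite S" "\<And>s. s \<in> S \<Longrightarrow> p s \<in> carrier A"
          "\<And>s. s \<in> S \<Longrightarrow> c s \<in> carrier (finite_dual R A)"
          "\<And>f. f \<in> F \<Longrightarrow>
            f = (\<Oplus>\<^bsub>finite_dual R A\<^esub>s\<in>S. f (p s) \<odot>\<^bsub>finite_dual R A\<^esub> c s)"
        by (rule finite_dual_common_basis [OF assms(2,4) F]) (rule that)
      show "\<exists>(S :: 'a set set) p c. (\<forall>s\<in>S. p s \<in> carrier A) \<and>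
          (\<forall>s\<in>S. c s \<in> carrier (finite_dual R A)) \<and>
          (\<forall>f\<in>F. f = (\<Oplus>\<^bsub>finite_dual R A\<^esub>s\<in>S. f (p s) \<odot>\<^bsub>finite_dual R A\<^esub> c s))"
        by (intro exI [of _ S] exI [of _ p] exI [of _ c] conjI ballI) (erule S)+
    qed
  qed
  then show ?thesis
    using T pr assms(3) by (simp add: rational_system_def)
qed

end
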